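(* For any $r>0$, any $n\ge1$ and any $\gamma>0$ (with $\delta=\frac1n\ln\gamma$), there exists an $n$-dimensional lattice $\Lambda$ with NLD $\delta$ whose average (and maximal) error probability over the real scalar fast fading channel described in the context satisfies $$P_e(\Lambda)\le\Pr\{\|\mathbf z\|>r\}+E\left\{\frac{V_n\gamma r^n}{\det(\mathbf H)}\right\}=\Pr\{\|\mathbf z\|>r\}+E\left\{\left(\frac{r}{r_{\mathrm{eff}}(\mathbf H)}\right)^n\right\},$$ where $V_n$ is the volume of the unit ball in $\mathbb R^n$ and $r_{\mathrm{eff}}(\mathbf H)$ is defined by $V_nr_{\mathrm{eff}}^n(\mathbf H)=\gamma^{-1}\det(\mathbf H)$.
   Context: Channel: $\mathbf y=\mathbf H\mathbf x+\mathbf z$, $\mathbf H=\mathrm{diag}(H_1,\dots,H_n)$ with $H_i$ i.i.d. positive fading coefficients, $\mathbf z\sim N(0,\sigma^2I_n)$ independent of $\mathbf H$; receiver knows $\mathbf H$. A lattice $\Lambda\subset\mathbb R^n$ with generator matrix $G_\Lambda$ has density $\gamma=1/|\det G_\Lambda|$ and NLD $\frac1n\ln\gamma$. The error probability of the lattice given $\mathbf H$ is the ML error probability of a transmitted lattice point, i.e. the probability that $\mathbf H\lambda+\mathbf z$ leaves the Voronoi cell of $\mathbf H\lambda$ in $\mathbf H\Lambda$ (the same for all $\lambda$); $P_e(\Lambda)$ is its expectation over $\mathbf H$. *)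

theory Defs
  imports "HOL-Analysis.Analysis" "HOL-Probability.Probability"
begin

definition lattice_of :: "real^'n^'n \<Rightarrow> (real^'n) set" where
  "lattice_of G = range (\<lambda>k::int^'n. G *v (\<chi> i. real_of_int (k $ i)))"

definition diag_app :: "('n::finite \<Rightarrow> real) \<Rightarrow> real^'n \<Rightarrow> real^'n" where
  "diag_app h v = (\<chi> i. h i * v $ i)"

definition noise_measure :: "real \<Rightarrow> (real^'n::finite) measure" where
  "noise_measure \<sigma> = density lborel (\<lambda>z. ennreal (\<Prod>i\<in>UNIV. normal_density 0 \<sigma> (z $ i)))"

text \<open>ML error event for transmitted lattice point lam given fading h: the received
  point H lam + z leaves the (closed) Voronoi cell of H lam in H Lambda.\<close>
definition ml_error_event :: "real^'n^'n \<Rightarrow> ('n \<Rightarrow> real) \<Rightarrow> real^'n \<Rightarrow> (real^'n) set" where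
  "ml_error_event G h lam = {z. \<exists>mu\<in>lattice_of G.
      dist (diag_app h lam + z) (diag_app h mu) < dist (diag_app h lam + z) (diag_app h lam)}"

definition cond_error_prob :: "real \<Rightarrow> real^'n^'n \<Rightarrow> ('n \<Rightarrow> real) \<Rightarrow> real^'n \<Rightarrow> ennreal" where
  "cond_error_prob \<sigma> G h lam = emeasure (noise_measure \<sigma>) (ml_error_event G h lam)"

definition lattice_error_prob :: "real measure \<Rightarrow> real \<Rightarrow> real^'n^'n \<Rightarrow> real^'n \<Rightarrow> ennreal" where
  "lattice_error_prob \<mu> \<sigma> G lam =
     (\<integral>\<^sup>+ h. cond_error_prob \<sigma> G h lam \<partial>(PiM UNIV (\<lambda>_::'n. \<mu>)))"

definition unit_ball_volume :: "'n::finite itself \<Rightarrow> real" where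
  "unit_ball_volume _ = measure lborel (ball (0::real^'n) 1)"

text \<open>Effective radius: V_n r_eff^n = det(H) / gamma.\<close>
definition r_eff :: "real \<Rightarrow> ('n::finite \<Rightarrow> real) \<Rightarrow> real" where
  "r_eff \<gamma> h = ((\<Prod>i\<in>UNIV. h i) / (\<gamma> * unit_ball_volume TYPE('n))) powr (1 / real CARD('n))"

end

theory Submission
  imports Defs
begin

text \<open>
  Davenport--Rogers averaging. Fix a coordinate \<open>0\<close> and, for \<open>\<alpha>\<close> large and \<open>\<delta> = 1 / (\<gamma> \<alpha>\<^sup>n\<^sup>-\<^sup>1)\<close>, take the
  lattice of points with coordinates \<open>\<alpha> (k\<^sub>i + k\<^sub>0 t\<^sub>i)\<close> for \<open>i \<noteq> 0\<close> and \<open>\<delta> k\<^sub>0\<close>. If \<open>\<parallel>z\<parallel> \<le> r\<close> and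
  decoding fails, then some nonzero lattice point lies in the ellipsoid \<open>\<parallel>z - H x\<parallel> < r\<close>. For fixed
  \<open>z\<close> and \<open>H\<close>, averaging the number of these points over \<open>t \<in> [0,1)\<^sup>n\<^sup>-\<^sup>1\<close> turns the sum over each
  hyperplane \<open>k\<^sub>0 = c \<noteq> 0\<close> into a section volume, and on each line in direction \<open>0\<close> the number of
  admissible \<open>c\<close> exceeds its expected value by at most one. So the average is at most the volume term
  \<open>V\<^sub>n \<gamma> r\<^sup>n / det H\<close>, plus the volume of a box projecting the ellipsoid, plus the number of points
  with \<open>k\<^sub>0 = 0\<close>. In expectation over \<open>H\<close> the last two terms vanish as \<open>\<alpha> \<rightarrow> \<infinity>\<close> when \<open>n \<ge> 2\<close>, and the
  first carries the factor \<open>Pr (\<parallel>z\<parallel> \<le> r) < 1\<close>. This strict slack absorbs the error, so that no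
  exact mean value theorem over the space of lattices is needed.
\<close>

section \<open>Counting integer vectors\<close>

text \<open>Membership of \<open>j\<close> says that \<open>u\<close> lies in
  \<open>j + c * [0,1)\<close>, so \<open>j\<close> runs through a half-open interval of length
  \<open>\<bar>c\<bar>\<close>. The exact count is the covering multiplicity of the tiling in one
  coordinate.\<close>

lemma int_window:
  fixes u :: real and c :: int
  assumes "c \<noteq> 0"
  defines "W \<equiv> {j::int. 0 \<le> (u - j) / c \<and> (u - j) / c < 1}"
  shows "finite W" "card W = nat \<bar>c\<bar>"
proof -
  have "finite W \<and> card W = nat \<bar>c\<bar>"
  proof (cases "c > 0")
    case True
    then have "W = {\<lfloor>u\<rfloor> - c<..\<lfloor>u\<rfloor>}"
      by (auto simp: W_def field_simps) linarith+
    then show ?thesis using True by simp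
  next
    case False
    with assms(1) have "c < 0" by simp
    then have "W = {\<lceil>u\<rceil>..<\<lceil>u\<rceil> - c}"
      by (auto simp: W_def field_simps) linarith+
    then show ?thesis using \<open>c < 0\<close> by simp
  qed
  then show "finite W" "card W = nat \<bar>c\<bar>" by auto
qed

text \<open>The surplus over the length becomes the projected-box error term when integers are
  counted along a line.\<close>

lemma int_interval_card:
  fixes S :: "int set" and a b :: real
  assumes "\<And>j. j \<in> S \<Longrightarrow> a < j \<and> j < b" "a \<le> b"
  shows "finite S" "real (card S) \<le> b - a + 1"
proof -
  have sub: "S \<subseteq> {\<lfloor>a\<rfloor> + 1..\<lceil>b\<rceil> - 1}"
    using assms(1) by (force simp: less_ceiling_iff floor_less_iff add1_zle_eq)
  then show "finite S" by (rule finite_subset) simp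
  have "card S \<le> card {\<lfloor>a\<rfloor> + 1..\<lceil>b\<rceil> - 1}"
    using sub by (intro card_mono) auto
  \<comment> \<open>When \<open>a = b\<close> is an integer the endpoint expression is -1 although
    the range is empty; the \<open>max\<close> accounts for this.\<close>
  also have "real \<dots> = max 0 (of_int (\<lceil>b\<rceil> - \<lfloor>a\<rfloor> - 1))" by (simp add: max_def) 
  also have "\<dots> \<le> b - a + 1" using assms(2) by linarith
  finally show "real (card S) \<le> b - a + 1" by simp
qed

text \<open>Fixing coordinate \<open>i0\<close> makes restriction to the other coordinates
  injective, and the restrictions lie in a finite product.\<close>

lemma card_int_vec_le:
  fixes S :: "'n::finite \<Rightarrow> int set" and c :: int
  assumes "\<And>i. i \<noteq> i0 \<Longrightarrow> finite (S i)"
  defines "T \<equiv> {k::int^'n. k $ i0 = c \<and> (\<forall>i. i \<noteq> i0 \<longrightarrow> k $ i \<in> S i)}"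
  shows "finite T" "card T \<le> (\<Prod>i\<in>-{i0}. card (S i))"
proof -
  let ?f = "\<lambda>k::int^'n. restrict (\<lambda>i. k $ i) (-{i0})"
  have inj: "inj_on ?f T"
  proof (rule inj_onI)
    fix k l assume kl: "k \<in> T" "l \<in> T" "?f k = ?f l"
    have "k $ i = l $ i" for i
      using kl(1,2) fun_cong[OF kl(3), of i] unfolding restrict_def by (cases "i = i0") (auto simp: T_def)
    then show "k = l" by (simp add: vec_eq_iff)
  qed
  have sub: "?f ` T \<subseteq> PiE (-{i0}) S" by (force simp: T_def)
  have fin: "finite (PiE (-{i0}) S)" using assms(1) by (intro finite_PiE) auto
  show "finite T" using inj sub fin by (meson inj_on_finite)
  have "card T \<le> card (PiE (-{i0}) S)" by (rule card_inj_on_le[OF inj sub fin])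
  then show "card T \<le> (\<Prod>i\<in>-{i0}. card (S i))" by (simp add: card_PiE)
qed

section \<open>Lebesgue measure in coordinates\<close>

interpretation lborel_prod: product_sigma_finite "\<lambda>_. lborel :: real measure"
  by standard

text \<open>A product measure is determined by its values on boxes, where the claim splits into a
  one-dimensional affine change of variables in each factor.\<close>

lemma PiM_lborel_affine:
  fixes s c :: "'i \<Rightarrow> real"
  assumes fin: "finite I" and c: "\<And>i. i \<in> I \<Longrightarrow> c i \<noteq> 0"
  shows "PiM I (\<lambda>_. lborel) =
    density (distr (PiM I (\<lambda>_. lborel)) (PiM I (\<lambda>_. lborel)) (\<lambda>t. \<lambda>i\<in>I. s i + c i * t i))
      (\<lambda>_. ennreal (\<Prod>i\<in>I. \<bar>c i\<bar>))" (is "_ = density (distr ?P ?P ?T) _")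
proof (rule lborel_prod.PiM_eqI[OF fin, symmetric])
  show "sets (density (distr ?P ?P ?T) (\<lambda>_. ennreal (\<Prod>i\<in>I. \<bar>c i\<bar>))) = sets ?P" by simp
  fix A :: "'i \<Rightarrow> real set" assume A: "\<And>i. i \<in> I \<Longrightarrow> A i \<in> sets lborel"
  have [measurable]: "Pi\<^sub>E I A \<in> sets ?P" using A fin by auto
  have 1: "emeasure lborel ((\<lambda>x. s i + c i * x) -` A i) * ennreal \<bar>c i\<bar> = emeasure lborel (A i)" if "i \<in> I" for i
  proof -
    have [measurable]: "A i \<in> sets borel" using A[OF that] by simp
    show ?thesis
      by (subst (2) lborel_real_affine[OF c[OF that], of "s i"])
         (simp add: emeasure_density nn_integral_cmult emeasure_distr mult.commute)
  qed
  have pre: "?T -` Pi\<^sub>E I A \<inter> space ?P = Pi\<^sub>E I (\<lambda>i. (\<lambda>x. s i + c i * x) -` A i)"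
    by (auto simp: space_PiM PiE_iff extensional_def)
  have "emeasure (density (distr ?P ?P ?T) (\<lambda>_. ennreal (\<Prod>i\<in>I. \<bar>c i\<bar>))) (Pi\<^sub>E I A)
      = ennreal (\<Prod>i\<in>I. \<bar>c i\<bar>) * emeasure ?P (Pi\<^sub>E I (\<lambda>i. (\<lambda>x. s i + c i * x) -` A i))"
    by (simp add: emeasure_density nn_integral_cmult emeasure_distr pre)
  also have "\<dots> = (\<Prod>i\<in>I. ennreal \<bar>c i\<bar>) * (\<Prod>i\<in>I. emeasure lborel ((\<lambda>x. s i + c i * x) -` A i))"
  proof (subst lborel_prod.emeasure_PiM[OF fin])
    fix i assume "i \<in> I"
    then have [measurable]: "A i \<in> sets borel" using A by simp
    show "(\<lambda>x. s i + c i * x) -` A i \<in> sets lborel"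
      using measurable_sets_borel[of "\<lambda>x. s i + c i * x" borel "A i"] by simp
  qed (simp add: prod_ennreal)
  also have "\<dots> = (\<Prod>i\<in>I. emeasure lborel (A i))"
    unfolding prod.distrib[symmetric] by (intro prod.cong refl) (simp add: 1[symmetric] mult.commute)
  finally show "emeasure (density (distr ?P ?P ?T) (\<lambda>_. ennreal (\<Prod>i\<in>I. \<bar>c i\<bar>))) (Pi\<^sub>E I A) = (\<Prod>i\<in>I. emeasure lborel (A i))" .
qed

lemma nn_integral_PiM_lborel_affine:
  fixes s c :: "'i \<Rightarrow> real"
  assumes fin: "finite I" and c: "\<And>i. i \<in> I \<Longrightarrow> c i \<noteq> 0"
    and g [measurable]: "g \<in> borel_measurable (PiM I (\<lambda>_. lborel))"
  shows "(\<integral>\<^sup>+t. g t \<partial>PiM I (\<lambda>_. lborel)) =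
    ennreal (\<Prod>i\<in>I. \<bar>c i\<bar>) * (\<integral>\<^sup>+t. g (\<lambda>i\<in>I. s i + c i * t i) \<partial>PiM I (\<lambda>_. lborel))"
  by (subst PiM_lborel_affine[OF fin c, of _ s])
     (auto simp: nn_integral_density nn_integral_distr nn_integral_cmult)

lemma measurable_vec_lambda [measurable]:
  "(\<lambda>f. \<chi> i. f i) \<in> PiM UNIV (\<lambda>_::'n::finite. lborel :: real measure) \<rightarrow>\<^sub>M borel"
  by (rule borel_measurable_euclidean_space[THEN iffD2]) (auto simp: Basis_vec_def inner_axis)

text \<open>Both measures agree on boxes. The product form allows a single coordinate to be split
  off by Tonelli.\<close>

lemma lborel_vec_eq_distr:
  "(lborel :: (real^'n) measure) = distr (PiM UNIV (\<lambda>_::'n::finite. lborel)) borel (\<lambda>f. \<chi> i. f i)"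
proof (rule lborel_eqI)
  fix l u :: "real^'n" assume that_le: "\<And>b. b \<in> Basis \<Longrightarrow> l \<bullet> b \<le> u \<bullet> b"
  then have le: "l $ i \<le> u $ i" for i
    using that_le[OF axis_in_Basis_iff[THEN iffD2], of 1 i] by (simp add: inner_axis)
  have pre: "(\<lambda>f. \<chi> i. f i) -` box l u \<inter> space (PiM UNIV (\<lambda>_::'n. lborel :: real measure)) = PiE UNIV (\<lambda>i. {l $ i<..<u $ i})"
    by (auto simp: mem_box_cart space_PiM PiE_iff)
  have "emeasure (distr (PiM UNIV (\<lambda>_::'n. lborel)) borel (\<lambda>f. \<chi> i. f i)) (box l u) = (\<Prod>i\<in>UNIV. ennreal (u $ i - l $ i))"
    by (simp add: emeasure_distr pre lborel_prod.emeasure_PiM le)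
  also have "\<dots> = ennreal (\<Prod>i\<in>UNIV. u $ i - l $ i)" using le by (simp add: prod_ennreal)
  also have "(\<Prod>i\<in>UNIV. u $ i - l $ i) = (\<Prod>b\<in>Basis. (u - l) \<bullet> b)"
  proof -
    have B: "(Basis :: (real^'n) set) = (\<lambda>i. axis i 1) ` UNIV" by (auto simp: Basis_vec_def)
    have "inj (\<lambda>i::'n. axis i (1::real))" by (auto simp: inj_on_def axis_eq_axis)
    then show ?thesis unfolding B by (subst prod.reindex) (auto simp: inner_axis)
  qed
  finally show "emeasure (distr (PiM UNIV (\<lambda>_::'n. lborel)) borel (\<lambda>f. \<chi> i. f i)) (box l u) = (\<Prod>b\<in>Basis. (u - l) \<bullet> b)" .
qed simp

lemma nn_integral_lborel_vec:
  fixes f :: "real^'n::finite \<Rightarrow> ennreal"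
  assumes [measurable]: "f \<in> borel_measurable borel"
  shows "(\<integral>\<^sup>+z. f z \<partial>lborel) = (\<integral>\<^sup>+x. f (\<chi> i. x i) \<partial>PiM UNIV (\<lambda>_::'n. lborel))"
  by (subst lborel_vec_eq_distr) (simp add: nn_integral_distr)

lemma unit_ball_volume_eq: "unit_ball_volume TYPE('n::finite) = unit_ball_vol (real CARD('n))"
  by (simp add: unit_ball_volume_def content_ball)

lemma unit_ball_volume_pos: "0 < unit_ball_volume TYPE('n::finite)"
  by (simp add: unit_ball_volume_eq unit_ball_vol_pos)

lemma norm_vec_less_iff:
  fixes v :: "real^'n::finite"
  assumes "0 < r"
  shows "norm v < r \<longleftrightarrow> (\<Sum>i\<in>UNIV. (v $ i)\<^sup>2) < r\<^sup>2"
  using assms by (simp add: norm_vec_def L2_set_def real_sqrt_less_iff[of _ "r\<^sup>2", symmetric])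

text \<open>Substituting \<open>x i = z i / a i + y i / a i\<close> turns the residual
  \<open>z i - a i * x i\<close> into \<open>- y i\<close>. The set becomes a ball of radius
  \<open>r\<close>, and the Jacobian is the product of the \<open>1 / a i\<close>.\<close>

lemma ellipsoid_volume:
  fixes z a :: "'n::finite \<Rightarrow> real"
  assumes a: "\<And>i. 0 < a i" and r: "0 < r"
  shows "(\<integral>\<^sup>+x. indicator {x. (\<Sum>i\<in>UNIV. (z i - a i * x i)\<^sup>2) < r\<^sup>2} x \<partial>PiM UNIV (\<lambda>_. lborel))
     = ennreal (unit_ball_volume TYPE('n) * r ^ CARD('n) / (\<Prod>i\<in>UNIV. a i))"
proof -
  have [measurable]: "(\<lambda>x. indicator {x. (\<Sum>i\<in>UNIV. (z i - a i * x i)\<^sup>2) < r\<^sup>2} x :: ennreal)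
      \<in> borel_measurable (PiM UNIV (\<lambda>_::'n. lborel))"
    by measurable
  have "(\<integral>\<^sup>+x. indicator {x. (\<Sum>i\<in>UNIV. (z i - a i * x i)\<^sup>2) < r\<^sup>2} x \<partial>PiM UNIV (\<lambda>_. lborel))
    = ennreal (\<Prod>i\<in>UNIV. \<bar>1 / a i\<bar>) * (\<integral>\<^sup>+x. indicator {x. (\<Sum>i\<in>UNIV. (z i - a i * x i)\<^sup>2) < r\<^sup>2}
        (\<lambda>i\<in>UNIV. z i / a i + (1 / a i) * x i) \<partial>PiM UNIV (\<lambda>_::'n. lborel))"
    using a by (intro nn_integral_PiM_lborel_affine) (auto simp: less_imp_neq[symmetric])
  also have "(\<lambda>x. indicator {x. (\<Sum>i\<in>UNIV. (z i - a i * x i)\<^sup>2) < r\<^sup>2}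
        (\<lambda>i\<in>UNIV. z i / a i + (1 / a i) * x i) :: ennreal) = (\<lambda>x. indicator (ball 0 r) (\<chi> i. x i))"
  proof
    fix x
    have "z i - a i * (z i / a i + x i / a i) = - x i" for i
      using a[of i] by (simp add: field_simps)
    then show "indicator {x. (\<Sum>i\<in>UNIV. (z i - a i * x i)\<^sup>2) < r\<^sup>2}
        (\<lambda>i\<in>UNIV. z i / a i + (1 / a i) * x i) = (indicator (ball 0 r) (\<chi> i. x i) :: ennreal)"
      by (simp add: indicator_def norm_vec_less_iff[OF r])
  qed
  also have "(\<integral>\<^sup>+x. indicator (ball 0 r) (\<chi> i. x i) \<partial>PiM UNIV (\<lambda>_::'n. lborel :: real measure)) = emeasure lborel (ball (0::real^'n) r)"
    using nn_integral_lborel_vec[of "indicator (ball (0::real^'n) r)"] by (simp add: borel_measurable_indicator)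
  also have "\<dots> = ennreal (unit_ball_volume TYPE('n) * r ^ CARD('n))"
    using r by (simp add: emeasure_ball unit_ball_volume_eq)
  also have "ennreal (\<Prod>i\<in>UNIV. \<bar>1 / a i\<bar>) * \<dots> = ennreal (unit_ball_volume TYPE('n) * r ^ CARD('n) / (\<Prod>i\<in>UNIV. a i))"
    using a unit_ball_volume_pos[where 'n='n] r
    by (subst ennreal_mult[symmetric])
       (auto simp: abs_of_pos prod_dividef less_imp_le intro!: prod_nonneg)
  finally show ?thesis .
qed

text \<open>The boxes \<open>k + c [0,1)\<^sup>n\<^sup>-\<^sup>1\<close> with integer \<open>k\<close> cover each point \<open>\<bar>c\<bar>\<^sup>n\<^sup>-\<^sup>1\<close> times, which compensates the
  Jacobian of \<open>t \<mapsto> k + c t\<close>.\<close>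

lemma tiling_integral_le:
  fixes g :: "('n::finite \<Rightarrow> real) \<Rightarrow> ennreal" and c :: int
  assumes [measurable]: "g \<in> borel_measurable (PiM (-{i0}) (\<lambda>_. lborel))" and c: "c \<noteq> 0"
  shows "(\<integral>\<^sup>+k. \<integral>\<^sup>+t. indicator (PiE (-{i0}) (\<lambda>_. {0..<1})) t * g (\<lambda>i\<in>-{i0}. of_int (k $ i) + of_int c * t i)
        \<partial>PiM (-{i0}) (\<lambda>_. lborel) \<partial>count_space {k::int^'n. k $ i0 = c})
      \<le> (\<integral>\<^sup>+u. g u \<partial>PiM (-{i0}) (\<lambda>_. lborel))" (is "?L \<le> _")
proof -
  let ?I = "-{i0}"
  let ?P = "PiM ?I (\<lambda>_. lborel :: real measure)"
  let ?W = "\<lambda>u::real. {j::int. 0 \<le> (u - j) / c \<and> (u - j) / c < 1}"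
  let ?in = "\<lambda>(k::int^'n) (u::'n \<Rightarrow> real). \<forall>i\<in>?I. 0 \<le> (u i - k $ i) / c \<and> (u i - k $ i) / c < 1"
  \<comment> \<open>The Jacobian of \<open>t \<mapsto> k + c * t\<close> on the coordinates other
    than \<open>i0\<close>. Both sides are compared after multiplication by \<open>C\<close>, which
    cancels because it is neither 0 nor infinite.\<close>
  define C where "C = ennreal (\<Prod>i\<in>?I. \<bar>real_of_int c\<bar>)"
  have C: "C \<noteq> 0" "C \<noteq> \<top>" using c by (auto simp: C_def)
  have eq: "C * (\<integral>\<^sup>+t. indicator (PiE ?I (\<lambda>_. {0..<1})) t * g (\<lambda>i\<in>?I. of_int (k $ i) + of_int c * t i) \<partial>?P)
     = (\<integral>\<^sup>+u. (if ?in k u then g u else 0) \<partial>?P)" for k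
  proof -
    have "(\<integral>\<^sup>+u. (if ?in k u then g u else 0) \<partial>?P) = C *
       (\<integral>\<^sup>+t. (\<lambda>u. if ?in k u then g u else 0) (\<lambda>i\<in>?I. of_int (k $ i) + of_int c * t i) \<partial>?P)"
      unfolding C_def using c by (intro nn_integral_PiM_lborel_affine) auto
    also have "(\<integral>\<^sup>+t. (\<lambda>u. if ?in k u then g u else 0) (\<lambda>i\<in>?I. of_int (k $ i) + of_int c * t i) \<partial>?P)
      = (\<integral>\<^sup>+t. indicator (PiE ?I (\<lambda>_. {0..<1})) t * g (\<lambda>i\<in>?I. of_int (k $ i) + of_int c * t i) \<partial>?P)"
      using c by (intro nn_integral_cong) (auto simp: indicator_def space_PiM PiE_iff)
    finally show ?thesis ..
  qed
  have "C * ?L = (\<integral>\<^sup>+k. \<integral>\<^sup>+u. (if ?in k u then g u else 0) \<partial>?P \<partial>count_space {k::int^'n. k $ i0 = c})"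
    by (subst nn_integral_cmult[symmetric]) (simp_all add: eq)
  \<comment> \<open>After the interchange the inner sum counts the boxes containing
    \<open>u\<close>, one window of integers per coordinate.\<close>
  also have "\<dots> = (\<integral>\<^sup>+u. \<integral>\<^sup>+k. (if ?in k u then g u else 0) \<partial>count_space {k::int^'n. k $ i0 = c} \<partial>?P)"
    by (subst nn_integral_count_space_nn_integral) (auto intro: countable_subset[OF subset_UNIV])
  also have "\<dots> \<le> (\<integral>\<^sup>+u. C * g u \<partial>?P)"
  proof (rule nn_integral_mono)
    fix u
    let ?T = "{k::int^'n. k $ i0 = c \<and> (\<forall>i. i \<noteq> i0 \<longrightarrow> k $ i \<in> ?W (u i))}"
    have fin: "finite ?T" and "card ?T \<le> (\<Prod>i\<in>?I. card (?W (u i)))"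
      using card_int_vec_le[of i0 "\<lambda>i. ?W (u i)" c] int_window(1)[OF c] by auto
    then have card: "real (card ?T) \<le> (\<Prod>i\<in>?I. \<bar>real_of_int c\<bar>)"
      unfolding int_window(2)[OF c] by (simp add: of_nat_power[symmetric] del: of_nat_power) (metis (no_types, lifting) of_nat_le_iff of_nat_nat abs_ge_zero of_int_abs of_nat_power of_int_of_nat_eq)
    have "(\<integral>\<^sup>+k. (if ?in k u then g u else 0) \<partial>count_space {k::int^'n. k $ i0 = c}) = (\<Sum>k\<in>?T. g u)"
      using fin by (subst nn_integral_count_space'[OF fin]) auto
    also have "\<dots> = ennreal (real (card ?T)) * g u" by (simp add: ennreal_of_nat_eq_real_of_nat)
    also have "\<dots> \<le> C * g u" unfolding C_def using card by (intro mult_right_mono ennreal_leI) auto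
    finally show "(\<integral>\<^sup>+k. (if ?in k u then g u else 0) \<partial>count_space {k::int^'n. k $ i0 = c}) \<le> C * g u" .
  qed
  also have "\<dots> = C * (\<integral>\<^sup>+u. g u \<partial>?P)" by (simp add: nn_integral_cmult)
  finally show ?thesis using C by (simp add: ennreal_mult_le_mult_iff)
qed

section \<open>Averaging over sheared lattices\<close>

text \<open>Each \<open>x\<close> lies in exactly one fibre, so inserting fibre indicators and
  exchanging the sums loses nothing. This slices integer vectors by their coordinate
  \<open>i0\<close>.\<close>

lemma nn_integral_count_space_fibres:
  fixes F :: "'a::countable \<Rightarrow> ennreal" and p :: "'a \<Rightarrow> 'b::countable"
  shows "(\<integral>\<^sup>+x. F x \<partial>count_space {x. p x \<in> B}) = (\<integral>\<^sup>+y. \<integral>\<^sup>+x. F x \<partial>count_space {x. p x = y} \<partial>count_space B)"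
proof -
  have "(\<integral>\<^sup>+y. \<integral>\<^sup>+x. F x \<partial>count_space {x. p x = y} \<partial>count_space B)
      = (\<integral>\<^sup>+y. \<integral>\<^sup>+x. F x * indicator {x. p x = y} x \<partial>count_space UNIV \<partial>count_space B)"
    by (simp add: nn_integral_count_space_indicator)
  also have "\<dots> = (\<integral>\<^sup>+x. \<integral>\<^sup>+y. F x * indicator {x. p x = y} x \<partial>count_space B \<partial>count_space UNIV)"
    by (subst nn_integral_count_space_nn_integral) auto
  also have "\<dots> = (\<integral>\<^sup>+x. F x * indicator {x. p x \<in> B} x \<partial>count_space UNIV)"
  proof (rule nn_integral_cong)
    fix x
    have "(\<integral>\<^sup>+y. F x * indicator {x. p x = y} x \<partial>count_space B) = (\<Sum>y\<in>B \<inter> {p x}. F x)"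
      by (subst nn_integral_count_space'[of "B \<inter> {p x}"]) (auto intro!: sum.cong)
    then show "(\<integral>\<^sup>+y. F x * indicator {x. p x = y} x \<partial>count_space B) = F x * indicator {x. p x \<in> B} x"
      by (auto simp: indicator_def)
  qed
  also have "\<dots> = (\<integral>\<^sup>+x. F x \<partial>count_space {x. p x \<in> B})"
    by (simp add: nn_integral_count_space_indicator)
  finally show ?thesis ..
qed

text \<open>For positive \<open>a\<close> this has centre \<open>z i / a i\<close> and semi-axes
  \<open>r / a i\<close>. Points are functions rather than vectors so that \<open>PiM\<close>
  applies directly.\<close>

definition ellipsoid :: "('n::finite \<Rightarrow> real) \<Rightarrow> ('n \<Rightarrow> real) \<Rightarrow> real \<Rightarrow> ('n \<Rightarrow> real) set" where
  "ellipsoid z a r = {x. (\<Sum>i\<in>UNIV. (z i - a i * x i)\<^sup>2) < r\<^sup>2}"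

text \<open>Lattice coordinates before scaling: the factors \<alpha> and \<delta> are moved into the
  coefficients \<open>a\<close> of the ellipsoid.\<close>

definition shear :: "'n \<Rightarrow> ('n \<Rightarrow> real) \<Rightarrow> int^'n \<Rightarrow> 'n \<Rightarrow> real" where
  "shear i0 t k = (\<lambda>i. if i = i0 then of_int (k $ i0) else of_int (k $ i) + of_int (k $ i0) * t i)"

lemma measurable_shear [measurable]:
  "(\<lambda>t. shear i0 t k) \<in> PiM (-{i0}) (\<lambda>_. lborel) \<rightarrow>\<^sub>M PiM UNIV (\<lambda>_. lborel)"
proof (rule measurable_PiM_single')
  fix i show "(\<lambda>t. shear i0 t k i) \<in> PiM (-{i0}) (\<lambda>_. lborel) \<rightarrow>\<^sub>M lborel"
    by (cases "i = i0") (simp_all add: shear_def)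
qed (auto simp: space_PiM)

lemma abs_less_of_ellipsoid:
  assumes "x \<in> ellipsoid z a r" "0 < r"
  shows "\<bar>z i - a i * x i\<bar> < r"
proof -
  have "(z i - a i * x i)\<^sup>2 \<le> (\<Sum>i\<in>UNIV. (z i - a i * x i)\<^sup>2)"
    by (rule member_le_sum) auto
  also have "\<dots> < r\<^sup>2" using assms by (simp add: ellipsoid_def)
  finally show ?thesis using assms(2) by (auto intro: power2_less_imp_less[of "\<bar>z i - a i * x i\<bar>"])
qed

text \<open>A line in direction \<open>i0\<close> meets the ellipsoid in an open interval whose
  length is the integral on the right. Counting integers there costs at most one more, and nothing
  if the line misses the ellipsoid.\<close>

lemma line_hits_ellipsoid:
  fixes u z a :: "'n::finite \<Rightarrow> real" and r :: real
  assumes a: "0 < a i0"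
  defines "g \<equiv> \<lambda>s. indicator (ellipsoid z a r) (u(i0 := s)) :: ennreal"
  shows "(\<integral>\<^sup>+c. g (of_int c) \<partial>count_space (B :: int set)) \<le> (\<integral>\<^sup>+s. g s \<partial>lborel) + (if \<exists>s. u(i0 := s) \<in> ellipsoid z a r then 1 else 0)"
proof -
  \<comment> \<open>The part of the squared radius left for coordinate \<open>i0\<close>; the line
    meets the ellipsoid exactly when \<open>w\<close> is positive.\<close>
  define w where "w = r\<^sup>2 - (\<Sum>i\<in>-{i0}. (z i - a i * u i)\<^sup>2)"
  have mem: "u(i0 := s) \<in> ellipsoid z a r \<longleftrightarrow> (z i0 - a i0 * s)\<^sup>2 < w" for s
  proof -
    have "(\<Sum>i\<in>UNIV. (z i - a i * (u(i0 := s)) i)\<^sup>2) = (z i0 - a i0 * s)\<^sup>2 + (\<Sum>i\<in>-{i0}. (z i - a i * u i)\<^sup>2)"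
      by (subst sum.remove[of _ i0]) (auto simp: Compl_eq_Diff_UNIV)
    then show ?thesis by (simp add: ellipsoid_def w_def) linarith
  qed
  show ?thesis
  proof (cases "w > 0")
    case False
    then have "u(i0 := s) \<notin> ellipsoid z a r" for s
      unfolding mem using zero_le_power2[of "z i0 - a i0 * s"] by linarith
    then show ?thesis by (simp add: g_def)
  next
    case True
    define l h where "l = (z i0 - sqrt w) / a i0" and "h = (z i0 + sqrt w) / a i0"
    have mem': "u(i0 := s) \<in> ellipsoid z a r \<longleftrightarrow> s \<in> {l<..<h}" for s
    proof -
      have "(z i0 - a i0 * s)\<^sup>2 < w \<longleftrightarrow> \<bar>z i0 - a i0 * s\<bar> < sqrt w"
        using True real_sqrt_less_iff[of "(z i0 - a i0 * s)\<^sup>2" w] by simp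
      also have "\<dots> \<longleftrightarrow> s \<in> {l<..<h}" using a by (auto simp: l_def h_def field_simps abs_less_iff)
      finally show ?thesis unfolding mem .
    qed
    have "l \<le> h" using a True by (simp add: l_def h_def divide_right_mono)
    let ?S = "{c::int. c \<in> B \<and> of_int c \<in> {l<..<h}}"
    have fin: "finite ?S" and card: "real (card ?S) \<le> h - l + 1"
      using int_interval_card[of ?S l h] \<open>l \<le> h\<close> by auto
    have "(\<integral>\<^sup>+c. g (of_int c) \<partial>count_space B) = (\<Sum>c\<in>?S. g (of_int c))"
      by (rule nn_integral_count_space'[OF fin]) (auto simp: g_def mem')
    also have "\<dots> = ennreal (real (card ?S))"
      by (simp add: g_def mem' ennreal_of_nat_eq_real_of_nat)
    also have "\<dots> \<le> ennreal (h - l) + 1"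
      using card \<open>l \<le> h\<close> by (simp add: ennreal_plus[symmetric] ennreal_leI del: ennreal_plus flip: ennreal_1)
    also have "ennreal (h - l) = (\<integral>\<^sup>+s. indicator {l<..<h} s \<partial>lborel)"
      using \<open>l \<le> h\<close> by simp
    also have "\<dots> = (\<integral>\<^sup>+s. g s \<partial>lborel)" 
      by (intro nn_integral_cong) (simp add: g_def mem' indicator_def)
    also have "1 = (if \<exists>s. u(i0 := s) \<in> ellipsoid z a r then 1 else (0::ennreal))"
      unfolding mem using True by (auto intro!: exI[of _ "z i0 / a i0"] simp: a less_imp_neq[symmetric])
    finally show ?thesis .
  qed
qed

lemma measurable_ellipsoid [measurable]:
  "Measurable.pred (PiM UNIV (\<lambda>_::'n::finite. lborel)) (\<lambda>x. x \<in> ellipsoid z a r)"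
  unfolding ellipsoid_def mem_Collect_eq by measurable

lemma measurable_indicator_ellipsoid [measurable]:
  "indicator (ellipsoid z a r) \<in> borel_measurable (PiM UNIV (\<lambda>_::'n::finite. lborel))"
  unfolding indicator_def by measurable

text \<open>For each value \<open>c\<close> of coordinate \<open>i0\<close>, tiling bounds the
  averaged sum over the other coordinates by a section integral. Summing the sections over
  \<open>c\<close> counts integers on lines, which gives the full volume plus that of a box
  containing the projection of the ellipsoid.\<close>

lemma hits_off_hyperplane:
  fixes a z :: "'n::finite \<Rightarrow> real"
  assumes a: "\<And>i. 0 < a i" and r: "0 < r"
  shows "(\<integral>\<^sup>+t. indicator (PiE (-{i0}) (\<lambda>_. {0..<1})) t *
      (\<integral>\<^sup>+k. indicator (ellipsoid z a r) (shear i0 t k) \<partial>count_space {k. k $ i0 \<noteq> 0})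
        \<partial>PiM (-{i0}) (\<lambda>_. lborel))
    \<le> ennreal (unit_ball_volume TYPE('n) * r ^ CARD('n) / (\<Prod>i\<in>UNIV. a i)) + ennreal (\<Prod>i\<in>-{i0}. 2 * r / a i)"
  (is "(\<integral>\<^sup>+t. ?b t * _ \<partial>?P) \<le> ?R")
proof -
  let ?g = "indicator (ellipsoid z a r) :: _ \<Rightarrow> ennreal"
  have UNIV: "UNIV = insert i0 (-{i0})" by auto
  have upd [measurable]: "(\<lambda>u. u(i0 := s)) \<in> ?P \<rightarrow>\<^sub>M PiM UNIV (\<lambda>_. lborel)" for s :: real
  proof (rule measurable_PiM_single')
    fix i show "(\<lambda>u. (u(i0 := s)) i) \<in> ?P \<rightarrow>\<^sub>M lborel" by (cases "i = i0") simp_all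
  qed (auto simp: space_PiM)
  \<comment> \<open>Each residual of a point of the ellipsoid is below \<open>r\<close> in absolute
    value, so only lines over this box can meet it.\<close>
  define B where "B = PiE (-{i0}) (\<lambda>i. {(z i - r) / a i<..<(z i + r) / a i})"
  have [measurable]: "B \<in> sets ?P" unfolding B_def by measurable
  have "(\<integral>\<^sup>+t. ?b t * (\<integral>\<^sup>+k. ?g (shear i0 t k) \<partial>count_space {k. k $ i0 \<noteq> 0}) \<partial>?P)
      = (\<integral>\<^sup>+k. \<integral>\<^sup>+t. ?b t * ?g (shear i0 t k) \<partial>?P \<partial>count_space {k::int^'n. k $ i0 \<in> {c. c \<noteq> 0}})"
    by (subst nn_integral_count_space_nn_integral[symmetric]) 
       (auto simp: nn_integral_cmult intro: countable_subset[OF subset_UNIV])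
  also have "\<dots> = (\<integral>\<^sup>+c. \<integral>\<^sup>+k. \<integral>\<^sup>+t. ?b t * ?g (shear i0 t k) \<partial>?P \<partial>count_space {k::int^'n. k $ i0 = c} \<partial>count_space {c. c \<noteq> 0})"
    by (rule nn_integral_count_space_fibres)
  \<comment> \<open>Here the average over the shear acts: as \<open>c\<close> is nonzero, the
    translates swept out by \<open>t\<close> tile the whole section.\<close>
  also have "\<dots> \<le> (\<integral>\<^sup>+c. \<integral>\<^sup>+u. ?g (u(i0 := of_int c)) \<partial>?P \<partial>count_space {c. c \<noteq> 0})"
  proof (rule nn_integral_mono, simp, goal_cases)
    case (1 c)
    have "(\<integral>\<^sup>+k. \<integral>\<^sup>+t. ?b t * ?g (shear i0 t k) \<partial>?P \<partial>count_space {k::int^'n. k $ i0 = c})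
       = (\<integral>\<^sup>+k. \<integral>\<^sup>+t. ?b t * ?g ((\<lambda>i\<in>-{i0}. of_int (k $ i) + of_int c * t i)(i0 := of_int c)) \<partial>?P \<partial>count_space {k::int^'n. k $ i0 = c})"
    proof (intro nn_integral_cong arg_cong2[where f = "(*)"] refl arg_cong[where f = ?g], goal_cases)
      case (1 k t)
      then show ?case by (auto simp: shear_def fun_eq_iff)
    qed
    also have "\<dots> \<le> (\<integral>\<^sup>+u. ?g (u(i0 := of_int c)) \<partial>?P)"
      using 1 by (intro tiling_integral_le) simp_all
    finally show ?case .
  qed
  also have "\<dots> = (\<integral>\<^sup>+u. \<integral>\<^sup>+c. ?g (u(i0 := of_int c)) \<partial>count_space {c. c \<noteq> 0} \<partial>?P)"
    by (rule nn_integral_count_space_nn_integral[symmetric]) (auto intro: countable_subset[OF subset_UNIV])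
  also have "\<dots> \<le> (\<integral>\<^sup>+u. (\<integral>\<^sup>+s. ?g (u(i0 := s)) \<partial>lborel) + indicator B u \<partial>?P)"
  proof (rule nn_integral_mono)
    fix u assume u: "u \<in> space ?P"
    have "u \<in> B" if "u(i0 := s) \<in> ellipsoid z a r" for s
    proof -
      have "(z i - r) / a i < u i \<and> u i < (z i + r) / a i" if "i \<noteq> i0" for i
        using abs_less_of_ellipsoid[OF \<open>u(i0 := s) \<in> _\<close> r, of i] that a[of i]
        by (auto simp: field_simps abs_less_iff)
      then show ?thesis using u by (auto simp: B_def space_PiM PiE_iff)
    qed
    then have ind: "(if \<exists>s. u(i0 := s) \<in> ellipsoid z a r then 1 else 0) \<le> (indicator B u :: ennreal)"
      by (auto simp: indicator_def)
    show "(\<integral>\<^sup>+c. ?g (u(i0 := of_int c)) \<partial>count_space {c. c \<noteq> 0}) \<le> (\<integral>\<^sup>+s. ?g (u(i0 := s)) \<partial>lborel) + indicator B u"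
      by (rule order_trans[OF line_hits_ellipsoid add_left_mono[OF ind]]) (rule a)
  qed
  also have "\<dots> = (\<integral>\<^sup>+u. (\<integral>\<^sup>+s. ?g (u(i0 := s)) \<partial>lborel) \<partial>?P) + emeasure ?P B"
  proof (subst nn_integral_add)
    have "(\<lambda>(u, s). u(i0 := s)) \<in> ?P \<Otimes>\<^sub>M lborel \<rightarrow>\<^sub>M PiM UNIV (\<lambda>_. lborel :: real measure)"
      using measurable_add_dim[of i0 "-{i0}" "\<lambda>_. lborel :: real measure"] UNIV by simp
    from measurable_compose[OF this measurable_indicator_ellipsoid[of z a r]]
    have "(\<lambda>(u, s). ?g (u(i0 := s))) \<in> borel_measurable (?P \<Otimes>\<^sub>M lborel)"
      by (simp add: case_prod_beta')
    then show "(\<lambda>u. \<integral>\<^sup>+s. ?g (u(i0 := s)) \<partial>lborel) \<in> borel_measurable ?P"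
      by (rule lborel.borel_measurable_nn_integral)
  qed auto
  also have "(\<integral>\<^sup>+u. (\<integral>\<^sup>+s. ?g (u(i0 := s)) \<partial>lborel) \<partial>?P) = (\<integral>\<^sup>+x. ?g x \<partial>PiM UNIV (\<lambda>_. lborel))"
    using lborel_prod.product_nn_integral_insert[of "-{i0}" i0 ?g] UNIV measurable_indicator_ellipsoid by simp
  also have "\<dots> = ennreal (unit_ball_volume TYPE('n) * r ^ CARD('n) / (\<Prod>i\<in>UNIV. a i))"
    unfolding ellipsoid_def by (rule ellipsoid_volume[OF a r])
  also have "emeasure ?P B = (\<Prod>i\<in>-{i0}. ennreal (2 * r / a i))"
    unfolding B_def using a r
    by (subst lborel_prod.emeasure_PiM)
       (auto intro!: prod.cong simp: divide_right_mono less_imp_le diff_divide_distrib[symmetric])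
  also have "\<dots> = ennreal (\<Prod>i\<in>-{i0}. 2 * r / a i)"
    using a r by (intro prod_ennreal) (simp add: less_imp_le)
  finally show ?thesis .
qed

text \<open>With \<open>k $ i0 = 0\<close> the shear has no effect, so the points are counted
  directly. Both \<open>z i\<close> and the residual are bounded by \<open>r\<close>, hence
  \<open>a i * k $ i\<close> stays below \<open>2 * r\<close> in absolute value. The final
  \<open>- 1\<close> discards \<open>k = 0\<close>.\<close>

lemma hits_on_hyperplane:
  fixes a z :: "'n::finite \<Rightarrow> real"
  assumes a: "\<And>i. 0 < a i" and r: "0 < r" and z: "\<And>i. \<bar>z i\<bar> \<le> r"
  shows "(\<integral>\<^sup>+k. indicator (ellipsoid z a r) (shear i0 t k) \<partial>count_space {k. k $ i0 = 0 \<and> k \<noteq> 0})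
    \<le> ennreal ((\<Prod>i\<in>-{i0}. 1 + 4 * r / a i) - 1)"
proof -
  let ?S = "\<lambda>i. {j::int. \<bar>of_int j\<bar> < 2 * r / a i}"
  let ?T = "{k::int^'n. k $ i0 = 0 \<and> (\<forall>i. i \<noteq> i0 \<longrightarrow> k $ i \<in> ?S i)}"
  have S: "finite (?S i)" "real (card (?S i)) \<le> 1 + 4 * r / a i" for i
    using int_interval_card[of "?S i" "- (2 * r / a i)" "2 * r / a i"] a[of i] r by (auto simp: abs_less_iff)
  have fin: "finite ?T" and "card ?T \<le> (\<Prod>i\<in>-{i0}. card (?S i))"
    using card_int_vec_le[of i0 ?S 0] S(1) by auto
  then have "real (card ?T) \<le> (\<Prod>i\<in>-{i0}. real (card (?S i)))"
    unfolding of_nat_prod[symmetric] of_nat_le_iff by simp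
  also have "\<dots> \<le> (\<Prod>i\<in>-{i0}. 1 + 4 * r / a i)" using S(2) by (intro prod_mono) auto
  finally have card: "real (card ?T) \<le> (\<Prod>i\<in>-{i0}. 1 + 4 * r / a i)" .
  have "0 \<in> ?T" using a r by simp
  have T: "k \<in> ?T" if "shear i0 t k \<in> ellipsoid z a r" "k $ i0 = 0" for k
  proof -
    have "\<bar>of_int (k $ i)\<bar> < 2 * r / a i" if "i \<noteq> i0" for i
    proof -
      have "\<bar>z i - a i * k $ i\<bar> < r"
        using abs_less_of_ellipsoid[OF \<open>shear i0 t k \<in> _\<close> r, of i] that \<open>k $ i0 = 0\<close> by (simp add: shear_def)
      then have "\<bar>a i * k $ i\<bar> < 2 * r" using z[of i] by linarith
      then show ?thesis using a[of i] by (simp add: abs_mult field_simps)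
    qed
    then show ?thesis using that by simp
  qed
  have "(\<integral>\<^sup>+k. indicator (ellipsoid z a r) (shear i0 t k) \<partial>count_space {k. k $ i0 = 0 \<and> k \<noteq> 0})
     = (\<Sum>k\<in>?T - {0}. indicator (ellipsoid z a r) (shear i0 t k))"
    using fin T by (intro nn_integral_count_space') (auto simp: indicator_def)
  also have "\<dots> \<le> (\<Sum>k\<in>?T - {0}. 1)" by (intro sum_mono) (auto simp: indicator_def)
  also have "\<dots> = ennreal (real (card ?T) - 1)"
  proof -
    have "0 < card ?T" unfolding card_gt_0_iff using fin \<open>0 \<in> ?T\<close> by blast
    then have "1 \<le> card ?T" by linarith
    then have "real (card (?T - {0})) = real (card ?T) - 1"
      using \<open>0 \<in> ?T\<close> by (simp only: card_Diff_singleton of_nat_diff of_nat_1)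
    then show ?thesis by (simp only: sum_constant mult_1_right ennreal_of_nat_eq_real_of_nat)
  qed
  also have "\<dots> \<le> ennreal ((\<Prod>i\<in>-{i0}. 1 + 4 * r / a i) - 1)" using card by (intro ennreal_leI) simp
  finally show ?thesis .
qed

section \<open>The error event\<close>

text \<open>The base of the root is positive, so the power undoes it; this identifies the integrands
  of the two expectations.\<close>

lemma r_eff_power:
  fixes h :: "'n::finite \<Rightarrow> real"
  assumes "\<And>i. 0 < h i" "0 < \<gamma>"
  shows "(r / r_eff \<gamma> h) ^ CARD('n) = unit_ball_volume TYPE('n) * \<gamma> * r ^ CARD('n) / (\<Prod>i\<in>UNIV. h i)"
proof -
  let ?x = "(\<Prod>i\<in>UNIV. h i) / (\<gamma> * unit_ball_volume TYPE('n))"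
  have pos: "0 < ?x" using assms unit_ball_volume_pos[where 'n='n] by (simp add: prod_pos)
  have "r_eff \<gamma> h ^ CARD('n) = r_eff \<gamma> h powr real CARD('n)"
    using pos by (subst powr_realpow) (simp_all add: r_eff_def del: divide_eq_0_iff)
  also have "\<dots> = ?x" using pos by (simp add: r_eff_def powr_powr abs_of_pos del: abs_divide)
  finally show ?thesis by (simp add: power_divide)
qed

section \<open>Generator matrices of the sheared lattices\<close>

definition shear_scale :: "'n \<Rightarrow> real \<Rightarrow> real \<Rightarrow> 'n \<Rightarrow> real" where
  "shear_scale i0 \<alpha> \<delta> i = (if i = i0 then \<delta> else \<alpha>)"

text \<open>A diagonal matrix times a unipotent one whose column \<open>i0\<close> carries
  \<open>t\<close>, so that the density is fixed while \<open>t\<close> varies.\<close>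

definition shear_matrix :: "'n \<Rightarrow> real \<Rightarrow> real \<Rightarrow> ('n \<Rightarrow> real) \<Rightarrow> real^'n::finite^'n" where
  "shear_matrix i0 \<alpha> \<delta> t =
     (\<chi> i j. shear_scale i0 \<alpha> \<delta> i * ((if i = j then 1 else 0) + (if i \<noteq> i0 \<and> j = i0 then t i else 0)))"

lemma shear_matrix_mult:
  "(shear_matrix i0 \<alpha> \<delta> t *v (\<chi> i. real_of_int (k $ i))) $ i = shear_scale i0 \<alpha> \<delta> i * shear i0 t k i"
  by (auto simp: matrix_vector_mult_def shear_matrix_def shear_def distrib_left distrib_right
      sum.distrib if_distrib[of "\<lambda>x. _ * x"] if_distrib[of "\<lambda>x. x * _"] sum.delta cong: if_cong)

lemma prod_shear_scale:
  "(\<Prod>i\<in>UNIV. shear_scale (i0::'n::finite) \<alpha> \<delta> i) = \<delta> * \<alpha> ^ (CARD('n) - 1)"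
proof -
  have "(\<Prod>i\<in>UNIV. shear_scale i0 \<alpha> \<delta> i) = shear_scale i0 \<alpha> \<delta> i0 * (\<Prod>i\<in>UNIV - {i0}. shear_scale i0 \<alpha> \<delta> i)"
    by (rule prod.remove) auto
  also have "(\<Prod>i\<in>UNIV - {i0}. shear_scale i0 \<alpha> \<delta> i) = (\<Prod>i\<in>UNIV - {i0}. \<alpha>)"
    by (rule prod.cong) (auto simp: shear_scale_def)
  finally show ?thesis by (simp add: shear_scale_def card_Diff_singleton)
qed

text \<open>The transpose arises from the diagonal matrix by adding to row \<open>i0\<close> a
  combination of the other rows, which preserves the determinant.\<close>

lemma det_shear_matrix:
  "det (shear_matrix i0 \<alpha> \<delta> t :: real^'n::finite^'n) = \<delta> * \<alpha> ^ (CARD('n) - 1)"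
proof -
  let ?s = "shear_scale i0 \<alpha> \<delta>"
  let ?A = "(\<chi> i j. if i = j then ?s i else 0) :: real^'n^'n"
  let ?x = "\<Sum>i\<in>-{i0}. t i *s row i ?A"
  have "?x \<in> vec.span {row j ?A |j. j \<noteq> i0}"
    by (intro vec.span_sum vec.span_scale vec.span_base) auto
  from det_row_span[OF this]
  have "det (\<chi> k. if k = i0 then row i0 ?A + ?x else row k ?A) = det ?A" .
  moreover have "(\<chi> k. if k = i0 then row i0 ?A + ?x else row k ?A) = transpose (shear_matrix i0 \<alpha> \<delta> t)"
    by (auto simp: vec_eq_iff transpose_def row_def shear_matrix_def if_distrib[of "\<lambda>x. _ * x"] sum.delta cong: if_cong)
  ultimately have "det (shear_matrix i0 \<alpha> \<delta> t) = det ?A" by (simp add: det_transpose)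
  also have "\<dots> = (\<Prod>i\<in>UNIV. ?s i)" by (subst det_diagonal) auto
  finally show ?thesis by (simp add: prod_shear_scale)
qed

lemma lattice_of_diff:
  assumes "x \<in> lattice_of G" "y \<in> lattice_of G"
  shows "x - y \<in> lattice_of G"
proof -
  obtain k l where "x = G *v (\<chi> i. real_of_int (k $ i))" "y = G *v (\<chi> i. real_of_int (l $ i))"
    using assms by (auto simp: lattice_of_def)
  then have "x - y = G *v (\<chi> i. real_of_int ((k - l) $ i))"
    by (simp add: vec_eq_iff matrix_vector_mult_def sum_subtractf right_diff_distrib)
  then show ?thesis unfolding lattice_of_def by (rule range_eqI)
qed

text \<open>If \<open>mu\<close> beats \<open>lam\<close>, then \<open>z\<close> is closer to the
  faded difference \<open>mu - lam\<close> than to the origin. The difference is a lattice point,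
  nonzero because the inequality is strict, and for \<open>norm z \<le> r\<close> its faded image is
  within \<open>r\<close> of \<open>z\<close>. The covering set does not mention \<open>lam\<close>,
  so one bound serves all transmitted points.\<close>

lemma ml_error_event_subset:
  fixes h t :: "'n::finite \<Rightarrow> real"
  assumes lam: "lam \<in> lattice_of (shear_matrix i0 \<alpha> \<delta> t)" and r: "0 < r"
  shows "ml_error_event (shear_matrix i0 \<alpha> \<delta> t) h lam \<subseteq> {z. norm z > r} \<union>
    {z. norm z \<le> r \<and> (\<exists>k\<in>{k. k \<noteq> 0}. shear i0 t k \<in> ellipsoid (($) z) (\<lambda>i. h i * shear_scale i0 \<alpha> \<delta> i) r)}"
proof
  let ?G = "shear_matrix i0 \<alpha> \<delta> t"
  fix z assume "z \<in> ml_error_event ?G h lam"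
  then obtain mu where mu: "mu \<in> lattice_of ?G"
    and *: "dist (diag_app h lam + z) (diag_app h mu) < dist (diag_app h lam + z) (diag_app h lam)"
    by (auto simp: ml_error_event_def)
  obtain k where k: "mu - lam = ?G *v (\<chi> i. real_of_int (k $ i))"
    using lattice_of_diff[OF mu lam] by (auto simp: lattice_of_def)
  have eq: "diag_app h lam + z - diag_app h mu = (\<chi> i. z $ i - h i * shear_scale i0 \<alpha> \<delta> i * shear i0 t k i)"
    using k by (simp add: vec_eq_iff diag_app_def shear_matrix_mult[symmetric] mult.assoc) (simp add: vec_eq_iff algebra_simps)
  have less: "norm (\<chi> i. z $ i - h i * shear_scale i0 \<alpha> \<delta> i * shear i0 t k i) < norm z"
    using * by (simp add: dist_norm eq)
  have "k \<noteq> 0"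
  proof
    assume "k = 0"
    then have "(\<chi> i. z $ i - h i * shear_scale i0 \<alpha> \<delta> i * shear i0 t k i) = z"
      by (simp add: vec_eq_iff shear_def)
    then show False using less by simp
  qed
  moreover have "shear i0 t k \<in> ellipsoid (($) z) (\<lambda>i. h i * shear_scale i0 \<alpha> \<delta> i) r" if "norm z \<le> r"
    using less that norm_vec_less_iff[OF r, of "\<chi> i. z $ i - h i * shear_scale i0 \<alpha> \<delta> i * shear i0 t k i"]
    by (simp add: ellipsoid_def)
  ultimately show "z \<in> {z. norm z > r} \<union>
    {z. norm z \<le> r \<and> (\<exists>k\<in>{k. k \<noteq> 0}. shear i0 t k \<in> ellipsoid (($) z) (\<lambda>i. h i * shear_scale i0 \<alpha> \<delta> i) r)}"
    by (cases "norm z \<le> r") auto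
qed

section \<open>The Gaussian noise\<close>

lemma sets_noise_measure [measurable_cong, simp]: "sets (noise_measure \<sigma>) = sets borel"
  by (simp add: noise_measure_def)

lemma space_noise_measure [simp]: "space (noise_measure \<sigma>) = UNIV"
  by (simp add: noise_measure_def)

lemma prob_space_noise_measure:
  assumes "0 < \<sigma>"
  shows "prob_space (noise_measure \<sigma> :: (real^'n::finite) measure)"
proof
  have "emeasure (noise_measure \<sigma> :: (real^'n) measure) UNIV
      = (\<integral>\<^sup>+z. (\<Prod>i\<in>UNIV. ennreal (normal_density 0 \<sigma> (z $ i))) \<partial>(lborel :: (real^'n) measure))"
    unfolding noise_measure_def by (subst emeasure_density) (auto simp: prod_ennreal)
  also have "\<dots> = (\<integral>\<^sup>+x. (\<Prod>i\<in>UNIV. ennreal (normal_density 0 \<sigma> (x i))) \<partial>PiM UNIV (\<lambda>_::'n. lborel))"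
    by (subst nn_integral_lborel_vec) auto
  also have "\<dots> = (\<Prod>i\<in>(UNIV::'n set). \<integral>\<^sup>+x. ennreal (normal_density 0 \<sigma> x) \<partial>lborel)"
    by (rule lborel_prod.product_nn_integral_prod) auto
  also have "(\<integral>\<^sup>+x. ennreal (normal_density 0 \<sigma> x) \<partial>lborel) = 1"
    using assms by (subst nn_integral_eq_integral) auto
  finally show "emeasure (noise_measure \<sigma> :: (real^'n) measure) (space (noise_measure \<sigma>)) = 1" by simp
qed

text \<open>The Gaussian density is positive everywhere and the complement of the ball has positive
  Lebesgue measure. This is the source of the strict slack.\<close>

lemma noise_measure_cball_less_1:
  assumes "0 < \<sigma>" 
  shows "measure (noise_measure \<sigma>) (cball (0::real^'n::finite) r) < 1"
proof -
  let ?N = "noise_measure \<sigma> :: (real^'n) measure"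
  interpret N: prob_space ?N by (rule prob_space_noise_measure[OF assms])
  have "{z::real^'n. norm z > r} \<notin> null_sets ?N"
  proof
    assume "{z::real^'n. norm z > r} \<in> null_sets ?N"
    then have "AE z in lborel. norm (z::real^'n) > r \<longrightarrow> (\<Prod>i\<in>UNIV. normal_density 0 \<sigma> (z $ i)) = 0"
      unfolding noise_measure_def by (subst (asm) null_sets_density_iff) (auto simp: ennreal_eq_0_iff simp del: prod_zero_iff elim!: eventually_mono intro!: order.antisym prod_nonneg)
    then have ae: "AE z in lborel. \<not> norm (z::real^'n) > r"
    proof (rule eventually_mono)
      fix z :: "real^'n"
      have "(\<Prod>i\<in>UNIV. normal_density 0 \<sigma> (z $ i)) > 0"
        using assms by (intro prod_pos) (auto simp: normal_density_pos)
      then show "norm z > r \<longrightarrow> (\<Prod>i\<in>UNIV. normal_density 0 \<sigma> (z $ i)) = 0 \<Longrightarrow> \<not> norm z > r" by (metis less_irrefl)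
    qed
    have "emeasure lborel {z::real^'n. norm z > r} = 0"
      using ae by (subst (asm) AE_iff_measurable[OF _ refl]) auto
    moreover obtain b :: "real^'n" where b: "b \<in> Basis" using nonempty_Basis by blast
    \<comment> \<open>The centre has norm \<open>\<bar>r\<bar> + 1\<close>, so every point of this
      open unit ball has norm above \<open>\<bar>r\<bar>\<close>.\<close>
    have "ball ((\<bar>r\<bar> + 1) *\<^sub>R b) 1 \<subseteq> {z. norm z > r}"
    proof
      fix z assume "z \<in> ball ((\<bar>r\<bar> + 1) *\<^sub>R b) 1"
      then have "norm ((\<bar>r\<bar> + 1) *\<^sub>R b - z) < 1" by (simp add: dist_norm)
      moreover have "norm ((\<bar>r\<bar> + 1) *\<^sub>R b) = \<bar>r\<bar> + 1" using b by simp
      ultimately show "z \<in> {z. norm z > r}"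
        using norm_triangle_ineq2[of "(\<bar>r\<bar> + 1) *\<^sub>R b" z] unfolding mem_Collect_eq by linarith
    qed
    then have "emeasure lborel (ball ((\<bar>r\<bar> + 1) *\<^sub>R b) 1) \<le> emeasure lborel {z::real^'n. norm z > r}"
      by (intro emeasure_mono) auto
    moreover have "emeasure lborel (ball ((\<bar>r\<bar> + 1) *\<^sub>R b) 1) > 0"
      by (simp add: emeasure_ball unit_ball_vol_pos)
    ultimately show False by simp
  qed
  then have "0 < N.prob {z. norm z > r}"
    by (auto simp: null_sets_def N.emeasure_eq_measure zero_less_measure_iff)
  moreover have "N.prob (UNIV - {z. norm z > r}) = 1 - N.prob {z. norm z > r}"
    using N.prob_compl[of "{z. norm z > r}"] by simp
  moreover have "UNIV - {z. norm z > r} = cball (0::real^'n) r" by auto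
  ultimately show ?thesis by simp
qed

lemma borel_measurable_nn_integral_count_space:
  fixes f :: "'i \<Rightarrow> 'a \<Rightarrow> ennreal"
  assumes "countable A" and [measurable]: "\<And>i. i \<in> A \<Longrightarrow> f i \<in> borel_measurable M"
  shows "(\<lambda>x. \<integral>\<^sup>+i. f i x \<partial>count_space A) \<in> borel_measurable M"
proof -
  interpret sigma_finite_measure "count_space A"
    by (rule sigma_finite_measure_count_space_countable[OF assms(1)])
  have "(\<lambda>(i, x). f i x) \<in> borel_measurable (count_space A \<Otimes>\<^sub>M M)"
    by (rule measurable_pair_measure_countable1[OF assms(1)]) simp
  from measurable_pair_swap[OF this]
  have "(\<lambda>(x, i). f i x) \<in> borel_measurable (M \<Otimes>\<^sub>M count_space A)" by (simp add: case_prod_beta')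
  then show ?thesis by (rule borel_measurable_nn_integral)
qed

section \<open>Averaging over fading and noise\<close>

text \<open>Written as an integral over the counting measure, the number of nonzero points near
  \<open>z\<close> can be exchanged with other integrals and may be infinite.\<close>

definition overlap :: "'n \<Rightarrow> ('n \<Rightarrow> real) \<Rightarrow> real \<Rightarrow> ('n \<Rightarrow> real) \<Rightarrow> ('n \<Rightarrow> real) \<Rightarrow> real^'n::finite \<Rightarrow> ennreal" where
  "overlap i0 s r t h z =
    (\<integral>\<^sup>+k. indicator (ellipsoid (($) z) (\<lambda>i. h i * s i) r) (shear i0 t k) \<partial>count_space {k. k \<noteq> 0})"

text \<open>Nonzero \<open>k\<close> are split by whether \<open>k $ i0\<close> vanishes: the first
  class needs the average over \<open>t\<close>, the second is bounded uniformly in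
  \<open>t\<close>.\<close>

lemma overlap_average:
  fixes h s :: "'n::finite \<Rightarrow> real" and z :: "real^'n"
  assumes hs: "\<And>i. 0 < h i * s i" and r: "0 < r" and z: "norm z \<le> r"
  shows "(\<integral>\<^sup>+t. indicator (PiE (-{i0}) (\<lambda>_. {0..<1})) t * overlap i0 s r t h z \<partial>PiM (-{i0}) (\<lambda>_. lborel))
    \<le> ennreal (unit_ball_volume TYPE('n) * r ^ CARD('n) / (\<Prod>i\<in>UNIV. h i * s i))
      + ennreal (\<Prod>i\<in>-{i0}. 2 * r / (h i * s i)) + ennreal ((\<Prod>i\<in>-{i0}. 1 + 4 * r / (h i * s i)) - 1)"
  (is "(\<integral>\<^sup>+t. ?b t * _ \<partial>?P) \<le> ?A + ?C")
proof -
  let ?g = "\<lambda>t k. indicator (ellipsoid (($) z) (\<lambda>i. h i * s i) r) (shear i0 t k) :: ennreal"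
  let ?off = "\<lambda>t. \<integral>\<^sup>+k. ?g t k \<partial>count_space {k::int^'n. k $ i0 \<noteq> 0}"
  have zi: "\<bar>z $ i\<bar> \<le> r" for i using component_le_norm_cart[of z i] z by linarith
  have split: "overlap i0 s r t h z \<le> ?off t + ?C" for t
  proof -
    have "overlap i0 s r t h z = (\<integral>\<^sup>+k. ?g t k * indicator {k. k \<noteq> 0} k \<partial>count_space UNIV)"
      by (simp add: overlap_def nn_integral_count_space_indicator)
    also have "\<dots> = (\<integral>\<^sup>+k. ?g t k * indicator {k. k $ i0 \<noteq> 0} k + ?g t k * indicator {k. k $ i0 = 0 \<and> k \<noteq> 0} k \<partial>count_space UNIV)"
      by (intro nn_integral_cong) (auto simp: indicator_def)
    also have "\<dots> = ?off t + (\<integral>\<^sup>+k. ?g t k \<partial>count_space {k. k $ i0 = 0 \<and> k \<noteq> 0})"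
      by (subst nn_integral_add) (simp_all add: nn_integral_count_space_indicator)
    also have "\<dots> \<le> ?off t + ?C"
      by (intro add_left_mono hits_on_hyperplane hs r zi)
    finally show ?thesis .
  qed
  have [measurable]: "?off \<in> borel_measurable ?P"
    by (rule borel_measurable_nn_integral_count_space) (auto intro: countable_subset[OF subset_UNIV])
  have "(\<integral>\<^sup>+t. ?b t * overlap i0 s r t h z \<partial>?P) \<le> (\<integral>\<^sup>+t. ?b t * (?off t + ?C) \<partial>?P)"
    by (intro nn_integral_mono mult_left_mono split) simp
  also have "\<dots> = (\<integral>\<^sup>+t. ?b t * ?off t \<partial>?P) + (\<integral>\<^sup>+t. ?C * ?b t \<partial>?P)"
    unfolding distrib_left by (subst nn_integral_add) (auto simp: mult.commute)
  \<comment> \<open>The cube of shears has measure 1, so the uniform bound passes through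
    unchanged.\<close>
  also have "(\<integral>\<^sup>+t. ?C * ?b t \<partial>?P) = ?C"
    by (subst nn_integral_cmult_indicator) (auto simp: lborel_prod.emeasure_PiM)
  also have "(\<integral>\<^sup>+t. ?b t * ?off t \<partial>?P) \<le> ?A"
    by (rule hits_off_hyperplane[OF hs r])
  finally show ?thesis by (simp add: add_right_mono)
qed

text \<open>Joint measurability is what the interchange of the shear average with fading and noise
  requires.\<close>

lemma measurable_overlap:
  fixes M :: "('n::finite \<Rightarrow> real) measure" and N :: "(real^'n) measure"
  assumes [measurable_cong]: "sets M = sets (PiM UNIV (\<lambda>_. borel))" "sets N = sets borel"
  shows "(\<lambda>(t, h, z). overlap i0 s r t h z) \<in> borel_measurable (PiM (-{i0}) (\<lambda>_. lborel) \<Otimes>\<^sub>M (M \<Otimes>\<^sub>M N))"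
proof -
  let ?Q = "PiM (-{i0}) (\<lambda>_. lborel :: real measure) \<Otimes>\<^sub>M (M \<Otimes>\<^sub>M N)"
  have [measurable]: "(\<lambda>w. shear i0 (fst w) k i) \<in> borel_measurable ?Q" for k i
    by (cases "i = i0") (simp_all add: shear_def)
  have [measurable]: "(\<lambda>w. snd (snd w) $ i) \<in> borel_measurable ?Q" for i
    by (rule measurable_compose[OF _ borel_measurable_nth]) measurable
  have [measurable]: "(\<lambda>w. fst (snd w) i) \<in> borel_measurable ?Q" for i
  proof (rule measurable_compose[of "\<lambda>w. fst (snd w)" _ M])
    show "(\<lambda>h. h i) \<in> borel_measurable M"
      unfolding measurable_cong_sets[OF assms(1) refl] by simp
  qed simp
  have "(\<lambda>w. \<integral>\<^sup>+k. (if (\<Sum>i\<in>UNIV. (snd (snd w) $ i - fst (snd w) i * s i * shear i0 (fst w) k i)\<^sup>2) < r\<^sup>2 then 1 else 0)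
      \<partial>count_space {k. k \<noteq> 0}) \<in> borel_measurable ?Q"
    by (rule borel_measurable_nn_integral_count_space) (auto intro: countable_subset[OF subset_UNIV])
  then show ?thesis
    by (simp add: overlap_def ellipsoid_def case_prod_beta' indicator_def of_bool_def)
qed

section \<open>Independent fading and its inverse moment\<close>

locale fast_fading = prob_space \<mu> for \<mu> :: "real measure" +
  fixes \<sigma> r :: real
  assumes sets_mu [measurable_cong]: "sets \<mu> = sets borel"
    and fading_pos: "AE x in \<mu>. 0 < x"
    and sigma_pos: "0 < \<sigma>" and r_pos: "0 < r"
begin

abbreviation fading :: "('n::finite \<Rightarrow> real) measure" where
  "fading \<equiv> PiM UNIV (\<lambda>_. \<mu>)"

text \<open>By independence the expectation of \<open>1 / det H\<close> is the \<open>n\<close>-th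
  power of this value. It may be infinite, and then the claimed bound is trivial.\<close>

definition inv_moment :: ennreal where "inv_moment = (\<integral>\<^sup>+x. ennreal (1 / x) \<partial>\<mu>)"

sublocale fading: product_prob_space "\<lambda>_::'n::finite. \<mu>" UNIV by unfold_locales

lemma fading_AE_pos: "AE h in fading. \<forall>i::'n::finite. 0 < h i"
proof -
  have "AE h in fading. 0 < h i" for i :: 'n
    by (rule AE_PiM_component) (auto intro: fading_pos prob_space_axioms)
  then show ?thesis by (simp add: AE_all_countable)
qed

text \<open>Independence factors the expectation; coordinates outside \<open>J\<close> carry the
  constant 1, of integral 1.\<close>

lemma nn_integral_fading_prod:
  fixes J :: "'n::finite set"
  assumes [measurable]: "f \<in> borel_measurable borel"
  shows "(\<integral>\<^sup>+h. (\<Prod>i\<in>J. f (h i)) \<partial>fading) = (\<integral>\<^sup>+x. f x \<partial>\<mu>) ^ card J"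
proof -
  have eq: "(\<Prod>i\<in>UNIV. if i \<in> J then g i else 1) = (\<Prod>i\<in>J. g i)" for g :: "'n \<Rightarrow> ennreal"
    by (simp add: prod.If_cases)
  have "(\<integral>\<^sup>+h. (\<Prod>i\<in>J. f (h i)) \<partial>fading) = (\<integral>\<^sup>+h. (\<Prod>i\<in>UNIV. (if i \<in> J then f else (\<lambda>_. 1)) (h i)) \<partial>fading)"
    by (simp add: eq if_distrib[of "\<lambda>f. f _"])
  also have "\<dots> = (\<Prod>i\<in>UNIV. \<integral>\<^sup>+x. (if i \<in> J then f else (\<lambda>_. 1)) x \<partial>\<mu>)"
    by (rule fading.product_nn_integral_prod) auto
  also have "\<dots> = (\<Prod>i\<in>UNIV. if i \<in> J then (\<integral>\<^sup>+x. f x \<partial>\<mu>) else 1)"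
    by (intro prod.cong refl) (auto simp: emeasure_space_1)
  finally show ?thesis by (simp add: eq)
qed

lemma inv_moment_pos: "0 < inv_moment"
proof (rule ccontr)
  assume "\<not> 0 < inv_moment"
  then have "AE x in \<mu>. ennreal (1 / x) = 0"
    by (subst nn_integral_0_iff_AE[symmetric]) (auto simp: inv_moment_def)
  with fading_pos have "AE x in \<mu>. False"
    by eventually_elim (auto simp: ennreal_eq_0_iff not_le[symmetric])
  then show False by simp
qed

lemma nn_integral_fading_inverse_prod:
  fixes J :: "'n::finite set"
  assumes "0 \<le> c"
  shows "(\<integral>\<^sup>+h. ennreal (\<Prod>i\<in>J. c / h i) \<partial>fading) = (ennreal c * inv_moment) ^ card J"
proof -
  have "(\<integral>\<^sup>+h. ennreal (\<Prod>i\<in>J. c / h i) \<partial>fading) = (\<integral>\<^sup>+h. (\<Prod>i\<in>J. ennreal c * ennreal (1 / h i)) \<partial>fading)"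
    using assms by (intro nn_integral_cong_AE eventually_mono[OF fading_AE_pos])
       (auto simp: prod_ennreal[symmetric] less_imp_le ennreal_mult[symmetric])
  also have "\<dots> = (\<integral>\<^sup>+x. ennreal c * ennreal (1 / x) \<partial>\<mu>) ^ card J"
    by (rule nn_integral_fading_prod) simp
  also have "(\<integral>\<^sup>+x. ennreal c * ennreal (1 / x) \<partial>\<mu>) = ennreal c * inv_moment"
    unfolding inv_moment_def by (rule nn_integral_cmult) simp
  finally show ?thesis .
qed

lemma nn_integral_fading_inverse_det:
  assumes "0 \<le> c"
  shows "(\<integral>\<^sup>+h. ennreal (c / (\<Prod>i\<in>UNIV. h i)) \<partial>(fading :: ('n::finite \<Rightarrow> real) measure)) = ennreal c * inv_moment ^ CARD('n)"
proof -
  have "(\<integral>\<^sup>+h. ennreal (c / (\<Prod>i\<in>UNIV. h i)) \<partial>(fading :: ('n \<Rightarrow> real) measure))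
     = (\<integral>\<^sup>+h. ennreal c * ennreal (\<Prod>i\<in>(UNIV::'n set). 1 / h i) \<partial>fading)"
    using assms by (intro nn_integral_cong_AE eventually_mono[OF fading_AE_pos])
       (auto simp: ennreal_mult[symmetric] prod_nonneg less_imp_le prod_dividef)
  also have "\<dots> = ennreal c * (\<integral>\<^sup>+h. ennreal (\<Prod>i\<in>(UNIV::'n set). 1 / h i) \<partial>fading)"
    by (rule nn_integral_cmult) simp
  finally show ?thesis by (simp add: nn_integral_fading_inverse_prod)
qed

text \<open>Adding 1 to both sides leaves a pure product, whose expectation factors by independence;
  the finite summand 1 is then cancelled.\<close>

lemma nn_integral_fading_count_bound:
  fixes J :: "'n::finite set"
  assumes c: "0 \<le> c" and m: "inv_moment = ennreal m" "0 \<le> m"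
  shows "(\<integral>\<^sup>+h. ennreal ((\<Prod>i\<in>J. 1 + c / h i) - 1) \<partial>fading) = ennreal ((1 + c * m) ^ card J - 1)"
    (is "?L = _")
proof -
  have "?L + 1 = (\<integral>\<^sup>+h. ennreal ((\<Prod>i\<in>J. 1 + c / h i) - 1) + 1 \<partial>(fading :: ('n \<Rightarrow> real) measure))"
    by (subst nn_integral_add) (auto simp: fading.P.emeasure_space_1)
  also have "\<dots> = (\<integral>\<^sup>+h. (\<Prod>i\<in>J. 1 + ennreal c * ennreal (1 / h i)) \<partial>fading)"
  proof (intro nn_integral_cong_AE eventually_mono[OF fading_AE_pos])
    fix h :: "'n \<Rightarrow> real" assume elim: "\<forall>i. 0 < h i"
    have "1 \<le> (\<Prod>i\<in>J. 1 + c / h i)" using elim c by (intro prod_ge_1) (simp add: less_imp_le)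
    then have "ennreal ((\<Prod>i\<in>J. 1 + c / h i) - 1) + 1 = ennreal (\<Prod>i\<in>J. 1 + c / h i)"
      by (simp add: ennreal_plus[symmetric] del: ennreal_plus flip: ennreal_1)
    also have "\<dots> = (\<Prod>i\<in>J. 1 + ennreal c * ennreal (1 / h i))"
      using elim c by (subst prod_ennreal[symmetric])
        (auto simp: less_imp_le ennreal_mult[symmetric] intro!: prod.cong)
    finally show "ennreal ((\<Prod>i\<in>J. 1 + c / h i) - 1) + 1 = (\<Prod>i\<in>J. 1 + ennreal c * ennreal (1 / h i))" .
  qed
  also have "\<dots> = (\<integral>\<^sup>+x. 1 + ennreal c * ennreal (1 / x) \<partial>\<mu>) ^ card J"
    by (rule nn_integral_fading_prod) simp
  also have "(\<integral>\<^sup>+x. 1 + ennreal c * ennreal (1 / x) \<partial>\<mu>) = 1 + ennreal c * inv_moment"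
    unfolding inv_moment_def by (subst nn_integral_add) (auto simp: nn_integral_cmult emeasure_space_1)
  also have "(1 + ennreal c * inv_moment) ^ card J = ennreal ((1 + c * m) ^ card J - 1) + 1"
    using c m by (simp add: ennreal_mult[symmetric] ennreal_power ennreal_plus[symmetric] del: ennreal_plus flip: ennreal_1)
  finally show ?thesis by simp
qed

text \<open>A union bound: the indicator that some nonzero point is close to \<open>z\<close> is at
  most the number of such points.\<close>

lemma cond_error_prob_le:
  fixes h t :: "'n::finite \<Rightarrow> real"
  assumes "lam \<in> lattice_of (shear_matrix i0 \<alpha> \<delta> t)"
  shows "cond_error_prob \<sigma> (shear_matrix i0 \<alpha> \<delta> t) h lam \<le> emeasure (noise_measure \<sigma>) {z::real^'n. norm z > r}
     + (\<integral>\<^sup>+z. indicator (cball 0 r) z * overlap i0 (shear_scale i0 \<alpha> \<delta>) r t h z \<partial>noise_measure \<sigma>)"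
proof -
  let ?N = "noise_measure \<sigma> :: (real^'n) measure"
  let ?E = "\<lambda>k. {z. shear i0 t k \<in> ellipsoid (($) z) (\<lambda>i. h i * shear_scale i0 \<alpha> \<delta> i) r}"
  let ?B = "{z. norm z \<le> r \<and> (\<exists>k\<in>{k. k \<noteq> 0}. z \<in> ?E k)}"
  have E [measurable]: "?E k \<in> sets ?N" for k
    unfolding ellipsoid_def mem_Collect_eq by measurable
  have B: "?B = cball 0 r \<inter> (\<Union>k\<in>{k. k \<noteq> 0}. ?E k)" by auto
  have Bm [measurable]: "?B \<in> sets ?N"
  proof -
    have "(\<Union>k\<in>{k. k \<noteq> 0}. ?E k) \<in> sets ?N"
      by (rule sets.countable_UN')
         (use E in \<open>auto simp del: sets_noise_measure intro: countable_subset[OF subset_UNIV]\<close>)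
    then show ?thesis unfolding B by (intro sets.Int) simp_all
  qed
  have gt [measurable]: "{z. norm z > r} \<in> sets ?N" by simp
  have "cond_error_prob \<sigma> (shear_matrix i0 \<alpha> \<delta> t) h lam \<le> emeasure ?N ({z. norm z > r} \<union> ?B)"
    unfolding cond_error_prob_def using ml_error_event_subset[OF assms r_pos, of h]
    by (intro emeasure_mono sets.Un gt Bm) simp
  also have "\<dots> \<le> emeasure ?N {z. norm z > r} + emeasure ?N ?B"
    by (rule emeasure_subadditive[OF gt Bm])
  also have "emeasure ?N ?B = (\<integral>\<^sup>+z. indicator ?B z \<partial>?N)"
    by (rule nn_integral_indicator[OF Bm, symmetric])
  also have "\<dots> \<le> (\<integral>\<^sup>+z. indicator (cball 0 r) z * overlap i0 (shear_scale i0 \<alpha> \<delta>) r t h z \<partial>?N)"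
  proof (rule nn_integral_mono)
    fix z
    show "indicator ?B z \<le> indicator (cball 0 r) z * overlap i0 (shear_scale i0 \<alpha> \<delta>) r t h z"
    proof (cases "z \<in> ?B")
      case True
      then obtain k where k: "k \<noteq> 0" "z \<in> ?E k" by auto
      have "(1::ennreal) = (\<integral>\<^sup>+l. indicator {k} l \<partial>count_space {k. k \<noteq> 0})"
        using k by simp
      also have "\<dots> \<le> overlap i0 (shear_scale i0 \<alpha> \<delta>) r t h z"
        unfolding overlap_def using k by (intro nn_integral_mono) (auto simp: indicator_def)
      finally show ?thesis using True by (simp add: indicator_def)
    qed simp
  qed
  finally show ?thesis by (simp add: add_left_mono)
qed

end

text \<open>In dimension 1 letting \<open>\<alpha>\<close> grow gains nothing, but there the bound is trivial: whenever an error
  with \<open>\<parallel>z\<parallel> \<le> r\<close> is possible, the volume term is at least 1.\<close>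

lemma one_le_volume_ratio_dim_1:
  fixes h t :: "'n::finite \<Rightarrow> real"
  assumes card: "CARD('n) = 1" and h: "\<And>i. 0 < h i" and \<gamma>: "0 < \<gamma>" and r: "0 < r"
    and z: "norm z \<le> r" and k: "k \<noteq> 0"
    and mem: "shear i0 t k \<in> ellipsoid (($) z) (\<lambda>i. h i * shear_scale i0 1 (1 / \<gamma>) i) r"
  shows "1 \<le> unit_ball_volume TYPE('n) * \<gamma> * r ^ CARD('n) / (\<Prod>i\<in>UNIV. h i)"
proof -
  obtain i where "UNIV = {i::'n}" using card by (metis card_1_singletonE)
  then have UNIV: "UNIV = {i0}" by (metis UNIV_I singletonD)
  have "k $ i0 \<noteq> 0" using k UNIV by (metis UNIV_I singletonD vec_eq_iff zero_index)
  then have k1: "1 \<le> \<bar>real_of_int (k $ i0)\<bar>" by linarith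
  have "\<bar>z $ i0 - h i0 * (1 / \<gamma>) * k $ i0\<bar> < r"
    using abs_less_of_ellipsoid[OF mem r, of i0] by (simp add: shear_def shear_scale_def)
  moreover have "\<bar>z $ i0\<bar> \<le> r" using component_le_norm_cart[of z i0] z by linarith
  ultimately have "\<bar>h i0 * (1 / \<gamma>) * k $ i0\<bar> < 2 * r" by linarith
  moreover have "h i0 * (1 / \<gamma>) * 1 \<le> h i0 * (1 / \<gamma>) * \<bar>real_of_int (k $ i0)\<bar>"
    using k1 h[of i0] \<gamma> by (intro mult_left_mono) (auto simp: less_imp_le)
  ultimately have "h i0 * (1 / \<gamma>) < 2 * r"
    using h[of i0] \<gamma> by (simp add: abs_mult)
  \<comment> \<open>The unit ball in dimension 1 has volume 2, so the ratio is
    \<open>2 * \<gamma> * r / h i0\<close>.\<close>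
  then show ?thesis
    using h[of i0] \<gamma> r by (simp add: unit_ball_volume_eq card UNIV field_simps)
qed

context fast_fading
begin

text \<open>The quantity to be made small by the choice of \<open>t\<close>; the cutoff to the ball
  is what later yields the factor below 1.\<close>

definition mean_overlap :: "'n \<Rightarrow> real \<Rightarrow> real \<Rightarrow> ('n::finite \<Rightarrow> real) \<Rightarrow> ennreal" where
  "mean_overlap i0 \<alpha> \<delta> t = (\<integral>\<^sup>+h. \<integral>\<^sup>+z. indicator (cball 0 r) z * overlap i0 (shear_scale i0 \<alpha> \<delta>) r t h z
     \<partial>noise_measure \<sigma> \<partial>fading)"

lemma measurable_overlap_fading:
  "(\<lambda>(t, h, z). indicator (cball 0 r) z * overlap i0 s r t h z)
     \<in> borel_measurable (PiM (-{i0}) (\<lambda>_. lborel) \<Otimes>\<^sub>M (fading \<Otimes>\<^sub>M (noise_measure \<sigma> :: (real^'n::finite) measure)))"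
proof -
  let ?Q = "PiM (-{i0}) (\<lambda>_. lborel) \<Otimes>\<^sub>M (fading \<Otimes>\<^sub>M (noise_measure \<sigma> :: (real^'n::finite) measure))"
  have "sets fading = sets (PiM UNIV (\<lambda>_::'n. borel))" by (rule sets_PiM_cong) (auto simp: sets_mu)
  then have [measurable]: "(\<lambda>w. overlap i0 s r (fst w) (fst (snd w)) (snd (snd w))) \<in> borel_measurable ?Q"
    using measurable_overlap[of fading "noise_measure \<sigma>" i0 s r] by (simp add: case_prod_beta')
  have [measurable]: "(\<lambda>w. indicator (cball 0 r) (snd (snd w)) :: ennreal) \<in> borel_measurable ?Q"
    by (rule measurable_compose[OF measurable_compose[OF measurable_snd measurable_snd]])
       (simp add: borel_measurable_indicator)
  show ?thesis unfolding case_prod_beta' by measurable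
qed

text \<open>Integrating the conditional bound over the fading. The same \<open>t\<close> works for
  every \<open>lam\<close>, which covers the maximal error probability.\<close>

lemma lattice_error_prob_le:
  fixes t :: "'n::finite \<Rightarrow> real"
  assumes lam: "lam \<in> lattice_of (shear_matrix i0 \<alpha> \<delta> t)" and t: "t \<in> space (PiM (-{i0}) (\<lambda>_. lborel))"
  shows "lattice_error_prob \<mu> \<sigma> (shear_matrix i0 \<alpha> \<delta> t) lam
    \<le> emeasure (noise_measure \<sigma>) {z::real^'n. norm z > r} + mean_overlap i0 \<alpha> \<delta> t"
proof -
  let ?N = "noise_measure \<sigma> :: (real^'n) measure"
  interpret N: prob_space ?N by (rule prob_space_noise_measure[OF sigma_pos])
  let ?f = "\<lambda>h z. indicator (cball 0 r) z * overlap i0 (shear_scale i0 \<alpha> \<delta>) r t h z"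
  have "(\<lambda>(h, z). ?f h z) \<in> borel_measurable (fading \<Otimes>\<^sub>M ?N)"
    using measurable_compose[OF measurable_Pair1'[OF t] measurable_overlap_fading[of i0 "shear_scale i0 \<alpha> \<delta>"]]
    by (simp add: case_prod_beta')
  then have [measurable]: "(\<lambda>h. \<integral>\<^sup>+z. ?f h z \<partial>?N) \<in> borel_measurable fading"
    by (rule N.borel_measurable_nn_integral)
  have "lattice_error_prob \<mu> \<sigma> (shear_matrix i0 \<alpha> \<delta> t) lam
     \<le> (\<integral>\<^sup>+h. emeasure ?N {z. norm z > r} + (\<integral>\<^sup>+z. ?f h z \<partial>?N) \<partial>fading)"
    unfolding lattice_error_prob_def by (intro nn_integral_mono cond_error_prob_le lam)
  also have "\<dots> = emeasure ?N {z. norm z > r} + (\<integral>\<^sup>+h. \<integral>\<^sup>+z. ?f h z \<partial>?N \<partial>fading)"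
    by (subst nn_integral_add) (auto simp: fading.P.emeasure_space_1)
  finally show ?thesis by (simp add: mean_overlap_def)
qed

text \<open>Tonelli moves the average over \<open>t\<close> inside, where the bound for fixed fading
  and noise applies almost everywhere; independence then evaluates each of its three terms.\<close>

lemma mean_overlap_average:
  fixes i0 :: "'n::finite"
  assumes \<alpha>: "0 < \<alpha>" and \<delta>: "0 < \<delta>" and m: "inv_moment = ennreal m" "0 \<le> m"
  defines "n \<equiv> CARD('n)"
  shows "(\<integral>\<^sup>+t. indicator (PiE (-{i0}) (\<lambda>_. {0..<1})) t * mean_overlap i0 \<alpha> \<delta> t \<partial>PiM (-{i0}) (\<lambda>_. lborel))
    \<le> ennreal (measure (noise_measure \<sigma>) (cball (0::real^'n) r) *
        (unit_ball_volume TYPE('n) * r ^ n / (\<delta> * \<alpha> ^ (n - 1)) * m ^ n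
          + (2 * r / \<alpha> * m) ^ (n - 1) + ((1 + 4 * r / \<alpha> * m) ^ (n - 1) - 1)))"
proof -
  let ?N = "noise_measure \<sigma> :: (real^'n) measure"
  let ?P = "PiM (-{i0}) (\<lambda>_. lborel :: real measure)"
  let ?b = "indicator (PiE (-{i0}) (\<lambda>_. {0..<1})) :: _ \<Rightarrow> ennreal"
  let ?s = "shear_scale i0 \<alpha> \<delta>"
  interpret N: prob_space ?N by (rule prob_space_noise_measure[OF sigma_pos])
  interpret HN: pair_prob_space "fading :: ('n \<Rightarrow> real) measure" ?N by unfold_locales
  interpret FP: finite_product_sigma_finite "\<lambda>_. lborel :: real measure" "-{i0}" by standard simp
  interpret PHN: pair_sigma_finite ?P "(fading :: ('n \<Rightarrow> real) measure) \<Otimes>\<^sub>M ?N"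
    by (intro pair_sigma_finite.intro FP.sigma_finite_measure_axioms HN.P.sigma_finite_measure_axioms)
  let ?F = "\<lambda>t w. indicator (cball 0 r) (snd w) * overlap i0 ?s r t (fst w) (snd w)"
  have F: "(\<lambda>x. ?F (fst x) (snd x)) \<in> borel_measurable (?P \<Otimes>\<^sub>M (fading \<Otimes>\<^sub>M ?N))"
    using measurable_overlap_fading[of i0 ?s] by (simp add: case_prod_beta')
  have Ft [measurable]: "?F t \<in> borel_measurable (fading \<Otimes>\<^sub>M ?N)" if "t \<in> space ?P" for t
    using measurable_compose[OF measurable_Pair1'[OF that] F] by simp
  have Fw [measurable]: "(\<lambda>t. ?F t w) \<in> borel_measurable ?P" if "w \<in> space (fading \<Otimes>\<^sub>M ?N)" for w
    using measurable_compose[OF measurable_Pair2'[OF that] F] by simp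
  \<comment> \<open>\<open>A\<close> is the volume term, \<open>B\<close> the projected box, and
    \<open>C\<close> the count on the hyperplane.\<close>
  define A where "A h = ennreal (unit_ball_volume TYPE('n) * r ^ n / (\<Prod>i\<in>UNIV. h i * ?s i))" for h
  define B where "B h = ennreal (\<Prod>i\<in>-{i0}. 2 * r / (h i * ?s i))" for h
  define C where "C h = ennreal ((\<Prod>i\<in>-{i0}. 1 + 4 * r / (h i * ?s i)) - 1)" for h
  have [measurable]: "A \<in> borel_measurable fading" "B \<in> borel_measurable fading" "C \<in> borel_measurable fading"
    unfolding A_def B_def C_def by measurable
  have card: "card (-{i0}) = n - 1" by (simp add: n_def Compl_eq_Diff_UNIV card_Diff_singleton)
  have "(\<integral>\<^sup>+t. ?b t * mean_overlap i0 \<alpha> \<delta> t \<partial>?P) = (\<integral>\<^sup>+t. \<integral>\<^sup>+w. ?b t * ?F t w \<partial>(fading \<Otimes>\<^sub>M ?N) \<partial>?P)"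
  proof (rule nn_integral_cong)
    fix t assume t: "t \<in> space ?P"
    have "mean_overlap i0 \<alpha> \<delta> t = (\<integral>\<^sup>+w. ?F t w \<partial>(fading \<Otimes>\<^sub>M ?N))"
      unfolding mean_overlap_def using N.nn_integral_fst[OF Ft[OF t]] by simp
    then show "?b t * mean_overlap i0 \<alpha> \<delta> t = (\<integral>\<^sup>+w. ?b t * ?F t w \<partial>(fading \<Otimes>\<^sub>M ?N))"
      using Ft[OF t] by (simp add: nn_integral_cmult)
  qed
  also have "\<dots> = (\<integral>\<^sup>+w. \<integral>\<^sup>+t. ?b t * ?F t w \<partial>?P \<partial>(fading \<Otimes>\<^sub>M ?N))"
  proof (rule PHN.Fubini'[symmetric])
    have [measurable]: "(\<lambda>x. ?b (fst x)) \<in> borel_measurable (?P \<Otimes>\<^sub>M (fading \<Otimes>\<^sub>M ?N))"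
      by (rule measurable_compose[OF measurable_fst]) simp
    show "(\<lambda>(t, w). ?b t * ?F t w) \<in> borel_measurable (?P \<Otimes>\<^sub>M (fading \<Otimes>\<^sub>M ?N))"
      unfolding case_prod_beta' using F by measurable
  qed
  also have "\<dots> \<le> (\<integral>\<^sup>+w. indicator (cball 0 r) (snd w) * (A (fst w) + B (fst w) + C (fst w)) \<partial>(fading \<Otimes>\<^sub>M ?N))"
  proof (rule nn_integral_mono_AE)
    have "AE w in fading \<Otimes>\<^sub>M ?N. \<forall>i::'n. 0 < fst w i"
    proof (rule HN.AE_pair_measure)
      show "{w \<in> space (fading \<Otimes>\<^sub>M ?N). \<forall>i. 0 < fst w i} \<in> sets (fading \<Otimes>\<^sub>M ?N)" by measurable
      show "AE h in fading. AE z in ?N. \<forall>i. 0 < fst (h, z) i"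
        by (rule eventually_mono[OF fading_AE_pos]) simp
    qed
    then show "AE w in fading \<Otimes>\<^sub>M ?N. (\<integral>\<^sup>+t. ?b t * ?F t w \<partial>?P) \<le> indicator (cball 0 r) (snd w) * (A (fst w) + B (fst w) + C (fst w))"
    proof (rule eventually_mono)
      fix w :: "('n \<Rightarrow> real) \<times> (real^'n)" assume w: "\<forall>i. 0 < fst w i"
      show "(\<integral>\<^sup>+t. ?b t * ?F t w \<partial>?P) \<le> indicator (cball 0 r) (snd w) * (A (fst w) + B (fst w) + C (fst w))"
      proof (cases "norm (snd w) \<le> r")
        case True
        have "0 < fst w i * ?s i" for i using w \<alpha> \<delta> by (simp add: shear_scale_def)
        from overlap_average[OF this r_pos True, of i0] True
        show ?thesis by (simp add: A_def B_def C_def n_def)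
      qed simp
    qed
  qed
  also have "\<dots> = (\<integral>\<^sup>+h. \<integral>\<^sup>+z. indicator (cball 0 r) z * (A h + B h + C h) \<partial>?N \<partial>fading)"
  proof -
    have [measurable]: "(\<lambda>w. indicator (cball 0 r) (snd w) :: ennreal) \<in> borel_measurable ((fading :: ('n \<Rightarrow> real) measure) \<Otimes>\<^sub>M ?N)"
      by (rule measurable_compose[OF measurable_snd]) (simp add: borel_measurable_indicator)
    have [measurable]: "(\<lambda>w. A (fst w) + B (fst w) + C (fst w)) \<in> borel_measurable ((fading :: ('n \<Rightarrow> real) measure) \<Otimes>\<^sub>M ?N)"
      by (rule measurable_compose[OF measurable_fst, of "\<lambda>h. A h + B h + C h"]) measurable
    show ?thesis by (subst N.nn_integral_fst[symmetric]) (simp_all add: borel_measurable_times_ennreal)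
  qed
  \<comment> \<open>The bound depends on \<open>z\<close> only through the ball indicator, so the
    noise contributes exactly the probability of the ball.\<close>
  also have "\<dots> = (\<integral>\<^sup>+h. emeasure ?N (cball 0 r) * (A h + B h + C h) \<partial>fading)"
    by (intro nn_integral_cong) (simp add: nn_integral_multc borel_measurable_indicator)
  also have "\<dots> = emeasure ?N (cball 0 r) * ((\<integral>\<^sup>+h. A h \<partial>fading) + (\<integral>\<^sup>+h. B h \<partial>fading) + (\<integral>\<^sup>+h. C h \<partial>fading))"
    by (simp add: nn_integral_cmult nn_integral_add)
  also have "(\<integral>\<^sup>+h. A h \<partial>fading) = ennreal (unit_ball_volume TYPE('n) * r ^ n / (\<delta> * \<alpha> ^ (n - 1)) * m ^ n)"
  proof -
    define c where "c = unit_ball_volume TYPE('n) * r ^ n / (\<delta> * \<alpha> ^ (n - 1))"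
    have c: "0 \<le> c" using \<alpha> \<delta> r_pos unit_ball_volume_pos[where 'n='n] by (simp add: c_def less_imp_le)
    have "A h = ennreal (c / (\<Prod>i\<in>UNIV. h i))" for h
      unfolding A_def prod.distrib prod_shear_scale n_def c_def by (simp add: mult.commute)
    then have "(\<integral>\<^sup>+h. A h \<partial>fading) = ennreal c * inv_moment ^ n"
      using nn_integral_fading_inverse_det[where 'n='n, OF c] by (simp add: n_def)
    also have "\<dots> = ennreal (c * m ^ n)" using c m by (simp add: ennreal_power ennreal_mult)
    finally show ?thesis by (simp add: c_def)
  qed
  also have "(\<integral>\<^sup>+h. B h \<partial>fading) = ennreal ((2 * r / \<alpha> * m) ^ (n - 1))"
  proof -
    have "B h = ennreal (\<Prod>i\<in>-{i0}. (2 * r / \<alpha>) / h i)" for h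
      unfolding B_def by (intro arg_cong[where f=ennreal] prod.cong) (auto simp: shear_scale_def)
    then show ?thesis
      using nn_integral_fading_inverse_prod[of "2 * r / \<alpha>" "-{i0}"] \<alpha> r_pos m
      by (simp add: card ennreal_power ennreal_mult[symmetric] less_imp_le)
  qed
  also have "(\<integral>\<^sup>+h. C h \<partial>fading) = ennreal ((1 + 4 * r / \<alpha> * m) ^ (n - 1) - 1)"
  proof -
    have "C h = ennreal ((\<Prod>i\<in>-{i0}. 1 + (4 * r / \<alpha>) / h i) - 1)" for h
      unfolding C_def by (intro arg_cong[where f="\<lambda>x. ennreal (x - 1)"] prod.cong) (auto simp: shear_scale_def)
    then show ?thesis
      using nn_integral_fading_count_bound[of "4 * r / \<alpha>" m "-{i0}"] \<alpha> r_pos m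
      by (simp add: card less_imp_le)
  qed
  also have "emeasure ?N (cball 0 r) = ennreal (N.prob (cball 0 r))" by (rule N.emeasure_eq_measure)
  finally show ?thesis
    using \<alpha> \<delta> r_pos m unit_ball_volume_pos[where 'n='n] one_le_power[of "1 + 4 * r / \<alpha> * m" "n - 1"]
    by (simp add: ennreal_mult'' ennreal_plus[symmetric] less_imp_le del: ennreal_plus)
qed

text \<open>The exponent \<open>n - 1\<close> is positive, so the error terms vanish as \<alpha>
  grows and the average tends to at most \<open>p * R < R\<close>. An average below \<open>R\<close>
  forces a value below \<open>R\<close>.\<close>

lemma exists_mean_overlap_less:
  fixes i0 :: "'n::finite"
  assumes card: "2 \<le> CARD('n)" and \<gamma>: "0 < \<gamma>" and m: "inv_moment = ennreal m" "0 < m"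
  defines "n \<equiv> CARD('n)"
  obtains \<alpha> t where "0 < \<alpha>" "t \<in> space (PiM (-{i0}) (\<lambda>_. lborel))"
    "mean_overlap i0 \<alpha> (1 / (\<gamma> * \<alpha> ^ (n - 1))) t < ennreal (unit_ball_volume TYPE('n) * \<gamma> * r ^ n * m ^ n)"
proof -
  let ?P = "PiM (-{i0}) (\<lambda>_. lborel :: real measure)"
  let ?b = "indicator (PiE (-{i0}) (\<lambda>_. {0..<1})) :: _ \<Rightarrow> ennreal"
  define R where "R = unit_ball_volume TYPE('n) * \<gamma> * r ^ n * m ^ n"
  define p where "p = measure (noise_measure \<sigma>) (cball (0::real^'n) r)"
  have R: "0 < R" using unit_ball_volume_pos[where 'n='n] \<gamma> r_pos m by (simp add: R_def)
  have p: "p < 1" unfolding p_def by (rule noise_measure_cball_less_1[OF sigma_pos])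
  let ?Q = "\<lambda>\<alpha>. p * (R + (2 * r / \<alpha> * m) ^ (n - 1) + ((1 + 4 * r / \<alpha> * m) ^ (n - 1) - 1))"
  have n1: "n - 1 \<noteq> 0" using card by (simp add: n_def)
  have lim: "((\<lambda>\<alpha>. c / \<alpha> * m) \<longlongrightarrow> 0) at_top" for c
    using tendsto_mult_left_zero[OF tendsto_divide_0[OF tendsto_const filterlim_at_top_imp_at_infinity[OF filterlim_ident]]] by fast
  have "(?Q \<longlongrightarrow> p * (R + 0 ^ (n - 1) + ((1 + 0) ^ (n - 1) - 1))) at_top"
    by (intro tendsto_intros lim)
  then have "(?Q \<longlongrightarrow> p * R) at_top" using n1 by (simp add: power_0_left)
  moreover have "p * R < R" using p R by simp
  ultimately have "eventually (\<lambda>\<alpha>. ?Q \<alpha> < R \<and> 0 < \<alpha>) at_top"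
    using order_tendstoD(2) eventually_gt_at_top eventually_conj by blast
  then obtain \<alpha> where \<alpha>: "?Q \<alpha> < R" "0 < \<alpha>" using eventually_happens by fastforce
  \<comment> \<open>This keeps the determinant at \<open>1 / \<gamma>\<close> and makes the volume
    term equal to \<open>R\<close> for every \<alpha>.\<close>
  define \<delta> where "\<delta> = 1 / (\<gamma> * \<alpha> ^ (n - 1))"
  have \<delta>: "0 < \<delta>" using \<alpha> \<gamma> by (simp add: \<delta>_def)
  have "unit_ball_volume TYPE('n) * r ^ n / (\<delta> * \<alpha> ^ (n - 1)) * m ^ n = R"
    using \<alpha> \<gamma> by (simp add: \<delta>_def R_def)
  then have "(\<integral>\<^sup>+t. ?b t * mean_overlap i0 \<alpha> \<delta> t \<partial>?P) \<le> ennreal (?Q \<alpha>)"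
    using mean_overlap_average[OF \<alpha>(2) \<delta> m(1), of i0] m(2) by (simp add: p_def n_def)
  also have "\<dots> < ennreal R" using \<alpha>(1) R by (simp add: ennreal_lessI)
  \<comment> \<open>Since the cube has volume 1, \<open>R\<close> is itself an integral over it and
    can be compared pointwise.\<close>
  also have "ennreal R = (\<integral>\<^sup>+t. ennreal R * ?b t \<partial>?P)"
    by (subst nn_integral_cmult_indicator) (auto simp: lborel_prod.emeasure_PiM)
  finally have less: "(\<integral>\<^sup>+t. ?b t * mean_overlap i0 \<alpha> \<delta> t \<partial>?P) < (\<integral>\<^sup>+t. ennreal R * ?b t \<partial>?P)" .
  have "\<exists>t\<in>space ?P. mean_overlap i0 \<alpha> \<delta> t < ennreal R"
  proof (rule ccontr)
    assume "\<not> (\<exists>t\<in>space ?P. mean_overlap i0 \<alpha> \<delta> t < ennreal R)"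
    then have "(\<integral>\<^sup>+t. ennreal R * ?b t \<partial>?P) \<le> (\<integral>\<^sup>+t. ?b t * mean_overlap i0 \<alpha> \<delta> t \<partial>?P)"
      by (intro nn_integral_mono) (auto simp: not_less indicator_def)
    with less show False by simp
  qed
  with \<alpha>(2) that show thesis unfolding R_def \<delta>_def by blast
qed

text \<open>For each fading either the volume term is at least 1 and dominates any probability, or
  every error has \<open>norm z > r\<close>.\<close>

lemma lattice_error_prob_dim_1:
  fixes t :: "'n::finite \<Rightarrow> real"
  assumes card: "CARD('n) = 1" and \<gamma>: "0 < \<gamma>"
    and lam: "lam \<in> lattice_of (shear_matrix i0 1 (1 / \<gamma>) t)"
  shows "lattice_error_prob \<mu> \<sigma> (shear_matrix i0 1 (1 / \<gamma>) t) lam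
    \<le> emeasure (noise_measure \<sigma>) {z::real^'n. norm z > r}
      + (\<integral>\<^sup>+h. ennreal (unit_ball_volume TYPE('n) * \<gamma> * r ^ CARD('n) / (\<Prod>i\<in>UNIV. h i)) \<partial>(fading :: ('n \<Rightarrow> real) measure))"
proof -
  let ?N = "noise_measure \<sigma> :: (real^'n) measure"
  let ?A = "\<lambda>h::'n \<Rightarrow> real. unit_ball_volume TYPE('n) * \<gamma> * r ^ CARD('n) / (\<Prod>i\<in>UNIV. h i)"
  interpret N: prob_space ?N by (rule prob_space_noise_measure[OF sigma_pos])
  have gt: "{z. norm z > r} \<in> sets ?N" by simp
  have "lattice_error_prob \<mu> \<sigma> (shear_matrix i0 1 (1 / \<gamma>) t) lam
      \<le> (\<integral>\<^sup>+h. emeasure ?N {z. norm z > r} + ennreal (?A h) \<partial>fading)"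
    unfolding lattice_error_prob_def
  proof (intro nn_integral_mono_AE eventually_mono[OF fading_AE_pos])
    fix h :: "'n \<Rightarrow> real" assume h: "\<forall>i. 0 < h i"
    show "cond_error_prob \<sigma> (shear_matrix i0 1 (1 / \<gamma>) t) h lam \<le> emeasure ?N {z. norm z > r} + ennreal (?A h)"
    proof (cases "1 \<le> ?A h")
      case True
      have "cond_error_prob \<sigma> (shear_matrix i0 1 (1 / \<gamma>) t) h lam \<le> 1"
        unfolding cond_error_prob_def by (rule N.emeasure_le_1)
      also have "\<dots> \<le> ennreal (?A h)" using True by (simp add: ennreal_ge_1)
      finally show ?thesis by (simp add: add_increasing)
    next
      case False
      then have "ml_error_event (shear_matrix i0 1 (1 / \<gamma>) t) h lam \<subseteq> {z. norm z > r}"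
        using ml_error_event_subset[OF lam r_pos, of h]
          one_le_volume_ratio_dim_1[OF card _ \<gamma> r_pos, of h _ _ i0 t] h by blast
      then show ?thesis
        unfolding cond_error_prob_def by (intro add_increasing2 emeasure_mono gt) simp_all
    qed
  qed
  also have "\<dots> = emeasure ?N {z. norm z > r} + (\<integral>\<^sup>+h. ennreal (?A h) \<partial>fading)"
    by (subst nn_integral_add) (auto simp: fading.P.emeasure_space_1)
  finally show ?thesis .
qed

end

section \<open>Existence of a good lattice of prescribed density\<close>

theorem theorem4p5:
  fixes \<mu> :: "real measure" and \<sigma> r \<gamma> :: real
  assumes "prob_space \<mu>" and "sets \<mu> = sets borel" and "AE x in \<mu>. 0 < x"
    and "\<sigma> > 0" and "r > 0" and "\<gamma> > 0"
  shows "\<exists>G::real^'n::finite^'n. 1 / \<bar>det G\<bar> = \<gamma> \<and>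
    (\<forall>lam\<in>lattice_of G. lattice_error_prob \<mu> \<sigma> G lam
       \<le> emeasure (noise_measure \<sigma>) {z::real^'n. norm z > r}
          + (\<integral>\<^sup>+ h. ennreal (unit_ball_volume TYPE('n) * \<gamma> * r ^ CARD('n) / (\<Prod>i\<in>UNIV. h i))
               \<partial>(PiM UNIV (\<lambda>_::'n. \<mu>)))) \<and>
    (\<integral>\<^sup>+ h. ennreal (unit_ball_volume TYPE('n) * \<gamma> * r ^ CARD('n) / (\<Prod>i\<in>UNIV. h i))
               \<partial>(PiM UNIV (\<lambda>_::'n. \<mu>)))
      = (\<integral>\<^sup>+ h. ennreal ((r / r_eff \<gamma> h) ^ CARD('n)) \<partial>(PiM UNIV (\<lambda>_::'n. \<mu>)))"
proof -
  interpret fast_fading \<mu> \<sigma> r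
    using assms by (simp add: fast_fading_def fast_fading_axioms_def)
  let ?E = "\<integral>\<^sup>+ h. ennreal (unit_ball_volume TYPE('n) * \<gamma> * r ^ CARD('n) / (\<Prod>i\<in>UNIV. h i)) \<partial>(fading :: ('n \<Rightarrow> real) measure)"
  let ?N = "noise_measure \<sigma> :: (real^'n) measure"
  have E: "?E = ennreal (unit_ball_volume TYPE('n) * \<gamma> * r ^ CARD('n)) * inv_moment ^ CARD('n)"
    using assms unit_ball_volume_pos[where 'n='n] by (intro nn_integral_fading_inverse_det) simp
  have "?E = (\<integral>\<^sup>+ h. ennreal ((r / r_eff \<gamma> h) ^ CARD('n)) \<partial>(PiM UNIV (\<lambda>_::'n. \<mu>)))"
    by (intro nn_integral_cong_AE eventually_mono[OF fading_AE_pos]) (simp add: r_eff_power assms)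
  moreover obtain i0 :: 'n where True by simp
  have det: "1 / \<bar>det (shear_matrix i0 \<alpha> (1 / (\<gamma> * \<alpha> ^ (CARD('n) - 1))) t)\<bar> = \<gamma>" if "0 < \<alpha>" for \<alpha> t
    using that assms by (simp add: det_shear_matrix)
  have "\<exists>G::real^'n^'n. 1 / \<bar>det G\<bar> = \<gamma> \<and>
    (\<forall>lam\<in>lattice_of G. lattice_error_prob \<mu> \<sigma> G lam \<le> emeasure ?N {z. norm z > r} + ?E)"
  proof (cases "CARD('n) = 1")
    case True
    with det[of 1] lattice_error_prob_dim_1[OF True \<open>0 < \<gamma>\<close>] show ?thesis
      by (intro exI[of _ "shear_matrix i0 1 (1 / \<gamma>) (\<lambda>_. 0)"]) auto
  next
    case False
    then have card: "2 \<le> CARD('n)" using zero_less_card_finite[where 'a='n] by linarith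
    show ?thesis
    proof (cases "inv_moment = \<top>")
      case True
      \<comment> \<open>The right-hand side is infinite, so any generator of the prescribed
        determinant will do.\<close>
      then have "?E = \<top>"
        unfolding E using assms unit_ball_volume_pos[where 'n='n] by (simp add: ennreal_mult_top top_power_ennreal)
      then show ?thesis using det[of 1] by (intro exI[of _ "shear_matrix i0 1 (1 / \<gamma>) (\<lambda>_. 0)"]) simp
    next
      case False
      \<comment> \<open>Positivity of \<open>m\<close> makes the target \<open>R\<close> positive,
        as the strict inequality \<open>p * R < R\<close> demands.\<close>
      then obtain m where m: "inv_moment = ennreal m" "0 < m"
        using inv_moment_pos by (cases inv_moment) auto
      obtain \<alpha> t where "0 < \<alpha>" and t: "t \<in> space (PiM (-{i0}) (\<lambda>_. lborel))" and
        less: "mean_overlap i0 \<alpha> (1 / (\<gamma> * \<alpha> ^ (CARD('n) - 1))) t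
          < ennreal (unit_ball_volume TYPE('n) * \<gamma> * r ^ CARD('n) * m ^ CARD('n))"
        using exists_mean_overlap_less[OF card \<open>0 < \<gamma>\<close> m, of i0] by blast
      have "ennreal (unit_ball_volume TYPE('n) * \<gamma> * r ^ CARD('n) * m ^ CARD('n)) = ?E"
        unfolding E m using assms m unit_ball_volume_pos[where 'n='n] by (simp add: ennreal_mult ennreal_power)
      with less have "lattice_error_prob \<mu> \<sigma> (shear_matrix i0 \<alpha> (1 / (\<gamma> * \<alpha> ^ (CARD('n) - 1))) t) lam
          \<le> emeasure ?N {z. norm z > r} + ?E"
        if "lam \<in> lattice_of (shear_matrix i0 \<alpha> (1 / (\<gamma> * \<alpha> ^ (CARD('n) - 1))) t)" for lam
        using order_trans[OF lattice_error_prob_le[OF that t] add_left_mono[OF less_imp_le]] by simp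
      with det[OF \<open>0 < \<alpha>\<close>] show ?thesis by blast
    qed
  qed
  ultimately show ?thesis by auto
qed

end
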